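(* Let $u=x_1^{a_1}\cdots x_n^{a_n}$ and $v=x_1^{b_1}\cdots x_n^{b_n}$ be monomials of degree $d\ge 2$ in $S=k[x_1,\ldots,x_n]$ with $u\geq_{lex}v$, and let $I=(\mathcal{L}(u,v))$ be a completely lexsegment ideal which has a linear resolution. Then the decomposition function $g:M(I)\rightarrow G(I)$ associated to the ordering $\prec$ of the generators in $G(I)$ is regular.
   Context: $S=k[x_1,\ldots,x_n]$ is a polynomial ring over a field $k$, with monomials ordered lexicographically with $x_1>x_2>\cdots>x_n$. $d\geq 2$ is an integer and $\mathcal{M}_d$ is the set of monomials of degree $d$ in $S$. For $u,v\in\mathcal{M}_d$ with $u\geq_{lex}v$, $\mathcal{L}(u,v)=\{w\in\mathcal{M}_d : u\geq_{lex}w\geq_{lex}v\}$ is a lexsegment; the ideal $(\mathcal{L}(u,v))$ has minimal monomial generating set $G(I)=\mathcal{L}(u,v)$. The shadow of a set $T$ of monomials is $\mathrm{Shad}(T)=\{m x_i : m\in T,\ 1\le i\le n\}$, and $\mathrm{Shad}^i(T)=\mathrm{Shad}(\mathrm{Shad}^{i-1}(T))$. A lexsegment is a completely lexsegment if all its iterated shadows are again lexsegments; a completely lexsegment ideal is an ideal generated by a completely lexsegment. An ideal generated in degree $d$ has a linear resolution if the $i$-th module in its minimal graded free resolution is generated in degree $d+i$ for all $i\ge 0$. The ordering $\prec$: for monomials $w=x_1^{\alpha_1}\cdots x_n^{\alpha_n}$ and $w'=x_1^{\beta_1}\cdots x_n^{\beta_n}$ of degree $d$, $w\prec w'$ if $\alpha_1<\beta_1$,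 or $\alpha_1=\beta_1$ and $w>_{lex}w'$. Let $u_1,\ldots,u_m$ be the elements of $G(I)$ listed so that $u_1\prec u_2\prec\cdots\prec u_m$. (The following notions are used for orderings for which $I$ has linear quotients, i.e. all $(u_1,\ldots,u_{j-1}):u_j$ with $2\le j\le m$ are generated by variables; the formulas depend only on the ordering.) Put $\mathrm{set}(u_j)=\{t\in\{1,\ldots,n\} : x_t\in(u_1,\ldots,u_{j-1}):u_j\}$ for $j=1,\ldots,m$, and $I_j=(u_1,\ldots,u_j)$. Let $M(I)$ be the set of all monomials in $I$. The decomposition function $g:M(I)\to G(I)$ is defined by $g(m)=u_j$, where $j$ is the smallest index such that $m\in I_j$. It is called regular if $\mathrm{set}(g(x_s w))\subseteq\mathrm{set}(w)$ for all $w\in G(I)$ and all $s\in\mathrm{set}(w)$. *)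

theory Defs
  imports "HOL-Library.Poly_Mapping" "HOL-Algebra.Ideal"
begin

section \<open>Monomials and lexsegments\<close>

text \<open>
  A monomial \<open>x\<^sub>1^\<alpha>\<^sub>1 \<cdots> x\<^sub>n^\<alpha>\<^sub>n\<close> is its exponent vector, with support in \<open>{1..n}\<close>; multiplication
  of monomials is addition of exponent vectors. The linear order that \<open>HOL-Library.Poly_Mapping\<close>
  puts on exponent vectors is the lexicographic order with \<open>x\<^sub>1 > x\<^sub>2 > \<cdots> > x\<^sub>n\<close>, see
  \<open>less_iff_lex\<close> below.
\<close>

type_synonym mon = "nat \<Rightarrow>\<^sub>0 nat"

definition mons :: "nat \<Rightarrow> mon set" where
  "mons n = {m. Poly_Mapping.keys m \<subseteq> {1..n}}"

definition mdeg :: "mon \<Rightarrow> nat" where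
  "mdeg m = (\<Sum>i\<in>Poly_Mapping.keys m. Poly_Mapping.lookup m i)"

definition mons_of_deg :: "nat \<Rightarrow> nat \<Rightarrow> mon set" where
  "mons_of_deg n d = {m \<in> mons n. mdeg m = d}"

lemma less_iff_lex:
  fixes w w' :: mon
  shows "w < w' \<longleftrightarrow>
    (\<exists>i. Poly_Mapping.lookup w i < Poly_Mapping.lookup w' i \<and>
         (\<forall>j<i. Poly_Mapping.lookup w j = Poly_Mapping.lookup w' j))"
  by (simp add: less_poly_mapping.rep_eq less_fun_def)

definition lexsegment :: "nat \<Rightarrow> nat \<Rightarrow> mon \<Rightarrow> mon \<Rightarrow> mon set" where
  "lexsegment n d u v = {w \<in> mons_of_deg n d. u \<ge> w \<and> w \<ge> v}"

definition is_lexsegment :: "nat \<Rightarrow> nat \<Rightarrow> mon set \<Rightarrow> bool" where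
  "is_lexsegment n d T \<longleftrightarrow>
    (\<exists>u\<in>mons_of_deg n d. \<exists>v\<in>mons_of_deg n d. u \<ge> v \<and> T = lexsegment n d u v)"

definition shad :: "nat \<Rightarrow> mon set \<Rightarrow> mon set" where
  "shad n T = {m + Poly_Mapping.single i 1 | m i. m \<in> T \<and> i \<in> {1..n}}"

definition completely_lexsegment :: "nat \<Rightarrow> nat \<Rightarrow> mon set \<Rightarrow> bool" where
  "completely_lexsegment n d T \<longleftrightarrow> (\<forall>i. is_lexsegment n (d + i) ((shad n ^^ i) T))"

definition prec :: "mon \<Rightarrow> mon \<Rightarrow> bool" (infix \<open>\<prec>\<close> 50) where
  "w \<prec> w' \<longleftrightarrow>
    Poly_Mapping.lookup w 1 < Poly_Mapping.lookup w' 1 \<or>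
    (Poly_Mapping.lookup w 1 = Poly_Mapping.lookup w' 1 \<and> w > w')"


section \<open>The polynomial ring and its ideals\<close>

text \<open>
  A polynomial maps monomials to coefficients; the ring operations are the convolution operations
  of \<open>HOL-Library.Poly_Mapping\<close>.
\<close>

type_synonym 'k mpoly = "mon \<Rightarrow>\<^sub>0 'k"

definition poly_ring :: "nat \<Rightarrow> ('k::field) mpoly ring" where
  "poly_ring n = \<lparr>carrier = {p. Poly_Mapping.keys p \<subseteq> mons n},
     monoid.mult = (*), one = 1, ring.zero = 0, add = (+)\<rparr>"

lemma cring_poly_ring: "cring (poly_ring n :: ('k::field) mpoly ring)"
proof -
  have z: "(0 :: mon) \<in> mons n" by (simp add: mons_def)
  have a: "m + m' \<in> mons n" if "m \<in> mons n" "m' \<in> mons n" for m m'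
    using that Poly_Mapping.keys_add[of m m'] by (auto simp: mons_def)
  have plus: "Poly_Mapping.keys (p + q) \<subseteq> mons n"
    if "Poly_Mapping.keys p \<subseteq> mons n" "Poly_Mapping.keys q \<subseteq> mons n"
    for p q :: "'k mpoly"
    using that Poly_Mapping.keys_add[of p q] by blast
  have times: "Poly_Mapping.keys (p * q) \<subseteq> mons n"
    if "Poly_Mapping.keys p \<subseteq> mons n" "Poly_Mapping.keys q \<subseteq> mons n"
    for p q :: "'k mpoly"
    using that Poly_Mapping.keys_mult[of p q] a by blast
  have neg: "\<exists>q. Poly_Mapping.keys q \<subseteq> mons n \<and> q + p = 0"
    if "Poly_Mapping.keys p \<subseteq> mons n" for p :: "'k mpoly"
    using that by (intro exI[of _ "- p"])
      (simp add: Poly_Mapping.keys.rep_eq uminus_poly_mapping.rep_eq)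
  show ?thesis
    by (rule cringI, rule abelian_groupI, rule_tac [7] comm_monoidI)
       (use z neg plus times in \<open>simp_all add: poly_ring_def add.assoc add.commute
          mult.assoc mult.commute distrib_left distrib_right\<close>)
qed

definition monomial_poly :: "mon \<Rightarrow> ('k::field) mpoly" where
  "monomial_poly m = Poly_Mapping.single m 1"

definition var :: "nat \<Rightarrow> ('k::field) mpoly" where
  "var t = monomial_poly (Poly_Mapping.single t 1)"

definition monomial_ideal :: "nat \<Rightarrow> mon set \<Rightarrow> ('k::field) mpoly set" where
  "monomial_ideal n T = Idl\<^bsub>poly_ring n\<^esub> (monomial_poly ` T)"

definition colon_ideal :: "nat \<Rightarrow> ('k::field) mpoly set \<Rightarrow> 'k mpoly \<Rightarrow> 'k mpoly set" where
  "colon_ideal n J f = {p \<in> carrier (poly_ring n). p * f \<in> J}"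


section \<open>Graded free resolutions\<close>

text \<open>
  The graded free module \<open>\<Oplus>\<^sub>j S(-b\<^sub>j)\<close>, given by the list \<open>bs\<close> of the degrees \<open>b\<^sub>j\<close> of its basis
  elements. An element is its coordinate vector, extended by 0 beyond the rank, so that equality
  of elements is equality of functions.
\<close>

definition free_mod :: "nat \<Rightarrow> nat list \<Rightarrow> (nat \<Rightarrow> ('k::field) mpoly) set" where
  "free_mod n bs = {f. (\<forall>j<length bs. f j \<in> carrier (poly_ring n)) \<and> (\<forall>j\<ge>length bs. f j = 0)}"

definition graded_part :: "nat \<Rightarrow> nat list \<Rightarrow> nat \<Rightarrow> (nat \<Rightarrow> ('k::field) mpoly) set" where
  "graded_part n bs e =
    {f \<in> free_mod n bs. \<forall>j<length bs. \<forall>m\<in>Poly_Mapping.keys (f j). mdeg m + bs ! j = e}"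

text \<open>\<open>\<mm>F\<close> for the graded maximal ideal \<open>\<mm> = (x\<^sub>1, \<dots>, x\<^sub>n)\<close>: all coordinates have constant term 0.\<close>

definition max_ideal_mod :: "nat \<Rightarrow> nat list \<Rightarrow> (nat \<Rightarrow> ('k::field) mpoly) set" where
  "max_ideal_mod n bs = {f \<in> free_mod n bs. \<forall>j. Poly_Mapping.lookup (f j) 0 = 0}"

text \<open>Homomorphisms of graded modules, homogeneous of degree 0.\<close>

definition graded_hom ::
  "nat \<Rightarrow> nat list \<Rightarrow> nat list \<Rightarrow> ((nat \<Rightarrow> ('k::field) mpoly) \<Rightarrow> (nat \<Rightarrow> 'k mpoly)) \<Rightarrow> bool" where
  "graded_hom n as bs \<phi> \<longleftrightarrow>
     \<phi> ` free_mod n as \<subseteq> free_mod n bs \<and>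
     (\<forall>f\<in>free_mod n as. \<forall>g\<in>free_mod n as. \<phi> (\<lambda>j. f j + g j) = (\<lambda>j. \<phi> f j + \<phi> g j)) \<and>
     (\<forall>p\<in>carrier (poly_ring n). \<forall>f\<in>free_mod n as. \<phi> (\<lambda>j. p * f j) = (\<lambda>j. p * \<phi> f j)) \<and>
     (\<forall>e. \<phi> ` graded_part n as e \<subseteq> graded_part n bs e)"

text \<open>
  A minimal graded free resolution \<open>\<cdots> \<rightarrow> F\<^sub>2 \<rightarrow> F\<^sub>1 \<rightarrow> F\<^sub>0 \<rightarrow> I \<rightarrow> 0\<close>, where \<open>bs i\<close> lists the degrees of
  the basis of \<open>F\<^sub>i\<close>, the differential is \<open>\<phi> i : F\<^sub>i\<^sub>+\<^sub>1 \<rightarrow> F\<^sub>i\<close>, and the augmentation \<open>\<epsilon>\<close> is a map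
  into \<open>S\<close>, viewed as the free module with one basis element of degree 0, with image \<open>I\<close>.
\<close>

definition min_graded_free_res ::
  "nat \<Rightarrow> ('k::field) mpoly set \<Rightarrow> (nat \<Rightarrow> nat list) \<Rightarrow>
   ((nat \<Rightarrow> 'k mpoly) \<Rightarrow> (nat \<Rightarrow> 'k mpoly)) \<Rightarrow>
   (nat \<Rightarrow> (nat \<Rightarrow> 'k mpoly) \<Rightarrow> (nat \<Rightarrow> 'k mpoly)) \<Rightarrow> bool" where
  "min_graded_free_res n I bs \<epsilon> \<phi> \<longleftrightarrow>
     graded_hom n (bs 0) [0] \<epsilon> \<and>
     (\<forall>i. graded_hom n (bs (Suc i)) (bs i) (\<phi> i)) \<and>
     \<epsilon> ` free_mod n (bs 0) = {f \<in> free_mod n [0]. f 0 \<in> I} \<and>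
     \<phi> 0 ` free_mod n (bs 1) = {f \<in> free_mod n (bs 0). \<epsilon> f = (\<lambda>_. 0)} \<and>
     (\<forall>i. \<phi> (Suc i) ` free_mod n (bs (Suc (Suc i))) =
          {f \<in> free_mod n (bs (Suc i)). \<phi> i f = (\<lambda>_. 0)}) \<and>
     (\<forall>i. \<phi> i ` free_mod n (bs (Suc i)) \<subseteq> max_ideal_mod n (bs i))"

text \<open>
  The minimal graded free resolution is unique up to isomorphism, so the property may be asked
  of some such resolution. A graded free module is generated in degree \<open>e\<close> iff its basis is.
\<close>

definition has_linear_resolution :: "nat \<Rightarrow> nat \<Rightarrow> ('k::field) mpoly set \<Rightarrow> bool" where
  "has_linear_resolution n d I \<longleftrightarrow>
     (\<exists>bs \<epsilon> \<phi>. min_graded_free_res n I bs \<epsilon> \<phi> \<and> (\<forall>i. \<forall>b\<in>set (bs i). b = d + i))"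


section \<open>The decomposition function\<close>

text \<open>
  Here \<open>gs\<close> is the list \<open>u\<^sub>1, \<dots>, u\<^sub>m\<close> of the generators, as polynomials and without repetitions.
  For \<open>w = u\<^sub>j\<close>, the list \<open>takeWhile (\<lambda>x. x \<noteq> w) gs\<close> is \<open>u\<^sub>1, \<dots>, u\<^sub>j\<^sub>-\<^sub>1\<close>.
\<close>

definition lq_set :: "nat \<Rightarrow> ('k::field) mpoly list \<Rightarrow> 'k mpoly \<Rightarrow> nat set" where
  "lq_set n gs w = {t \<in> {1..n}.
     var t \<in> colon_ideal n (Idl\<^bsub>poly_ring n\<^esub> (set (takeWhile (\<lambda>x. x \<noteq> w) gs))) w}"

text \<open>
  Only meaningful for monomials \<open>p\<close> in the ideal generated by \<open>gs\<close>. List indices start at 0, so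
  \<open>take (Suc j) gs\<close> generates \<open>I\<^sub>j\<^sub>+\<^sub>1\<close> and \<open>gs ! j\<close> is \<open>u\<^sub>j\<^sub>+\<^sub>1\<close>.
\<close>

definition decomp_fun :: "nat \<Rightarrow> ('k::field) mpoly list \<Rightarrow> 'k mpoly \<Rightarrow> 'k mpoly" where
  "decomp_fun n gs p =
     gs ! (LEAST j. j < length gs \<and> p \<in> Idl\<^bsub>poly_ring n\<^esub> (set (take (Suc j) gs)))"

definition regular_decomp :: "nat \<Rightarrow> ('k::field) mpoly list \<Rightarrow> bool" where
  "regular_decomp n gs \<longleftrightarrow>
     (\<forall>w\<in>set gs. \<forall>s\<in>lq_set n gs w. lq_set n gs (decomp_fun n gs (var s * w)) \<subseteq> lq_set n gs w)"

end

theory Submission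
  imports Defs
begin

text \<open>
  Write \<open>u\<^sub>1, v\<^sub>1\<close> for the exponents of \<open>x\<^sub>1\<close> in \<open>u, v\<close>. For a generator \<open>w\<close>, an index \<open>t\<close> lies in
  \<open>set(w)\<close> iff \<open>t \<ge> 2\<close> and either \<open>x\<^sub>t w / x\<^sub>1 \<ge> v\<close> or \<open>x\<^sub>t w / x\<^sub>i \<le> u\<close> for some \<open>i > t\<close> with
  \<open>x\<^sub>i | w\<close>. If \<open>u\<^sub>1 = v\<^sub>1\<close>, regularity follows by comparing monomials. If \<open>u\<^sub>1 > v\<^sub>1\<close>, it follows once
  every \<open>t \<ge> 2\<close> that is smaller than the last index of \<open>w\<close> lies in \<open>set(w)\<close>. If this fails for
  some \<open>t < i\<close> with \<open>x\<^sub>i | w\<close>, put \<open>h = x\<^sub>t w / (x\<^sub>1 x\<^sub>i)\<close>; then \<open>h x\<^sub>1 > u\<close> and \<open>h x\<^sub>n < v\<close> are not in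
  \<open>I\<close>, but \<open>h x\<^sub>1 x\<^sub>k \<in> \<mm>I\<close> for all \<open>k \<ge> 2\<close>, since the shadow is a lexsegment. So
  \<open>h x\<^sub>1 \<partial>(e\<^sub>2 \<and> \<dots> \<and> e\<^sub>n)\<close> is a Koszul cycle with coefficients in \<open>I\<close> and nonlinear degree. For a
  linear resolution it must be a boundary, and comparing the coefficients of \<open>h x\<^sub>1 x\<^sub>n\<close> gives a
  contradiction. To see that it is a boundary, one lifts the cycle step by step through the
  resolution, lowering the Koszul degree and raising the homological degree, until a nonlinear
  element of a syzygy module remains, which lies in \<open>\<mm>\<close> times that module.
\<close>


section \<open>Monomials and monomial ideals\<close>

definition xv :: "nat \<Rightarrow> mon" where
  "xv i = Poly_Mapping.single i 1"

lemma lookup_xv [simp]: "Poly_Mapping.lookup (xv i) j = (if i = j then 1 else 0)"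
  by (simp add: xv_def lookup_single)

lemma keys_xv [simp]: "Poly_Mapping.keys (xv i) = {i}"
  by (simp add: xv_def)

lemma keys_mon_add: "Poly_Mapping.keys (m + m' :: mon) = Poly_Mapping.keys m \<union> Poly_Mapping.keys m'"
  by (auto simp: in_keys_iff lookup_add)

lemma mdeg_superset:
  assumes "finite A" "Poly_Mapping.keys m \<subseteq> A"
  shows "mdeg m = (\<Sum>i\<in>A. Poly_Mapping.lookup m i)"
  unfolding mdeg_def using assms by (intro sum.mono_neutral_left) (auto simp: in_keys_iff)

lemma mdeg_add: "mdeg (m + m') = mdeg m + mdeg m'"
proof -
  let ?A = "Poly_Mapping.keys m \<union> Poly_Mapping.keys m'"
  have "mdeg k = (\<Sum>i\<in>?A. Poly_Mapping.lookup k i)" if "k \<in> {m, m', m + m'}" for k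
    using that by (intro mdeg_superset) (auto simp: keys_mon_add)
  then show ?thesis by (simp add: lookup_add sum.distrib)
qed

lemma mdeg_xv [simp]: "mdeg (xv i) = 1"
  by (simp add: mdeg_def)

lemma mdeg_eq_0_iff [simp]: "mdeg m = 0 \<longleftrightarrow> m = 0"
  by (auto simp: mdeg_def in_keys_iff poly_mapping_eq_iff fun_eq_iff)

lemma mons_add_iff: "m + m' \<in> mons n \<longleftrightarrow> m \<in> mons n \<and> m' \<in> mons n"
  by (simp add: mons_def keys_mon_add)

lemma xv_in_mons [simp]: "xv i \<in> mons n \<longleftrightarrow> i \<in> {1..n}"
  by (simp add: mons_def)

lemma mon_sub_xv: "Poly_Mapping.lookup m i > 0 \<Longrightarrow> m - xv i + xv i = m"
  by (rule poly_mapping_eqI) (auto simp: lookup_add lookup_minus)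

lemma ex_mon_sub_xv: "Poly_Mapping.lookup m i > 0 \<Longrightarrow> \<exists>m'. m = m' + xv i"
  using mon_sub_xv by metis


section \<open>Coefficients of products with monomials and variables\<close>

lemma lookup_single_mult_add:
  fixes p :: "('k::comm_ring_1) mpoly"
  shows "Poly_Mapping.lookup (Poly_Mapping.single k c * p) (m + k) = c * Poly_Mapping.lookup p m"
  unfolding add.commute[of m k] by (simp add: lookup_mult lookup_single when_mult)

lemma lookup_var_mult_add [simp]:
  fixes p :: "('k::field) mpoly"
  shows "Poly_Mapping.lookup (var i * p) (m + xv i) = Poly_Mapping.lookup p m"
  using lookup_single_mult_add[of "xv i" 1 p m] by (simp add: var_def monomial_poly_def xv_def)

lemma lookup_var_mult_eq_0:
  fixes p :: "('k::field) mpoly"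
  assumes "Poly_Mapping.lookup m i = 0"
  shows "Poly_Mapping.lookup (var i * p) m = 0"
proof -
  have "m \<noteq> xv i + q" for q
    using assms by (auto simp: lookup_add)
  then show ?thesis
    by (simp add: lookup_mult lookup_single when_mult var_def monomial_poly_def xv_def)
qed

lemma keys_var_mult:
  fixes p :: "('k::field) mpoly"
  shows "Poly_Mapping.keys (var i * p) \<subseteq> (\<lambda>m. m + xv i) ` Poly_Mapping.keys p"
proof
  fix m assume m: "m \<in> Poly_Mapping.keys (var i * p)"
  then obtain m' where "m = m' + xv i"
    using lookup_var_mult_eq_0[of m i p] ex_mon_sub_xv[of m i] by (auto simp: in_keys_iff)
  then show "m \<in> (\<lambda>m. m + xv i) ` Poly_Mapping.keys p"
    using m by (auto simp: in_keys_iff)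
qed

lemma monomial_poly_add: "monomial_poly (m + m') = monomial_poly m * (monomial_poly m' :: ('k::field) mpoly)"
  by (simp add: monomial_poly_def mult_single)

lemma keys_monomial_poly [simp]: "Poly_Mapping.keys (monomial_poly m :: ('k::field) mpoly) = {m}"
  by (simp add: monomial_poly_def)

lemma monomial_poly_inj [simp]:
  "monomial_poly m = (monomial_poly m' :: ('k::field) mpoly) \<longleftrightarrow> m = m'"
  using keys_monomial_poly by (metis singleton_inject)

lemma var_eq: "var i = monomial_poly (xv i)"
  by (simp add: var_def xv_def)

section \<open>Closure properties of the polynomial ring\<close>

abbreviation polys :: "nat \<Rightarrow> ('k::field) mpoly set" where
  "polys n \<equiv> carrier (poly_ring n)"

lemma polys_iff: "p \<in> polys n \<longleftrightarrow> Poly_Mapping.keys p \<subseteq> mons n"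
  by (simp add: poly_ring_def)

lemma poly_ring_simps [simp]:
  "x \<otimes>\<^bsub>poly_ring n\<^esub> y = x * y" "x \<oplus>\<^bsub>poly_ring n\<^esub> y = x + y"
  "\<zero>\<^bsub>poly_ring n\<^esub> = 0" "\<one>\<^bsub>poly_ring n\<^esub> = 1"
  by (simp_all add: poly_ring_def)

lemma polys_zero [simp]: "0 \<in> polys n"
  and polys_one [simp]: "1 \<in> polys n"
  by (simp_all add: polys_iff mons_def)

lemma polys_add: "p \<in> polys n \<Longrightarrow> q \<in> polys n \<Longrightarrow> p + q \<in> polys n"
  using cring.cring_simprules(1)[OF cring_poly_ring] by force

lemma polys_mult: "p \<in> polys n \<Longrightarrow> q \<in> polys n \<Longrightarrow> p * q \<in> polys n"
  using cring.cring_simprules(5)[OF cring_poly_ring] by force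

lemma polys_uminus [simp]: "- p \<in> polys n \<longleftrightarrow> p \<in> polys n"
  by (simp add: polys_iff)

lemma polys_diff: "p \<in> polys n \<Longrightarrow> q \<in> polys n \<Longrightarrow> p - q \<in> polys n"
  using polys_add[of p n "- q"] by simp

lemma polys_sum: "(\<And>i. i \<in> A \<Longrightarrow> f i \<in> polys n) \<Longrightarrow> sum f A \<in> polys n"
  by (induction A rule: infinite_finite_induct) (auto intro: polys_add)

lemma polys_monomial_poly [simp]: "monomial_poly m \<in> polys n \<longleftrightarrow> m \<in> mons n"
  by (simp add: polys_iff)

lemma polys_var [simp]: "var i \<in> polys n \<longleftrightarrow> i \<in> {1..n}"
  by (simp add: var_eq)

lemma polys_neg_one_power [simp]: "(-1) ^ k \<in> polys n"
  by (induction k) (auto intro: polys_mult)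

definition multiples :: "nat \<Rightarrow> mon set \<Rightarrow> mon set" where
  "multiples n T = {t + m | t m. t \<in> T \<and> m \<in> mons n}"

lemma multiples_add: "m \<in> multiples n T \<Longrightarrow> m' \<in> mons n \<Longrightarrow> m + m' \<in> multiples n T"
  unfolding multiples_def by (force simp: mons_add_iff add.assoc)

text \<open>The polynomials supported on multiples of \<open>T\<close> form an ideal containing the
  generators; conversely a polynomial is the sum of its terms, each a multiple of a generator. Ideal
  membership thus becomes a condition on supports.\<close>

lemma monomial_ideal_eq:
  assumes "T \<subseteq> mons n"
  shows "monomial_ideal n T = {p :: ('k::field) mpoly. Poly_Mapping.keys p \<subseteq> multiples n T}"
    (is "_ = ?J")
proof
  interpret cring "poly_ring n :: 'k mpoly ring" by (rule cring_poly_ring)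
  have sub: "monomial_poly ` T \<subseteq> polys n" using assms by auto
  have J_pc: "?J \<subseteq> polys n"
  proof
    have "multiples n T \<subseteq> mons n" using assms by (auto simp: multiples_def mons_add_iff)
    then show "p \<in> polys n" if "p \<in> ?J" for p using that by (auto simp: polys_iff)
  qed
  have "ideal ?J (poly_ring n)"
  proof (rule idealI)
    show "ring (poly_ring n :: 'k mpoly ring)" by (rule ring_axioms)
    show "subgroup ?J (add_monoid (poly_ring n))"
    proof
      show "?J \<subseteq> carrier (add_monoid (poly_ring n))" using J_pc by simp
      show "x \<otimes>\<^bsub>add_monoid (poly_ring n)\<^esub> y \<in> ?J" if "x \<in> ?J" "y \<in> ?J" for x y :: "'k mpoly"
        using that Poly_Mapping.keys_add[of x y] by auto
      show "\<one>\<^bsub>add_monoid (poly_ring n)\<^esub> \<in> ?J" by simp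
      fix x assume x: "x \<in> ?J"
      have "\<ominus>\<^bsub>poly_ring n\<^esub> x = - x"
        using J_pc x by (intro minus_equality) auto
      then show "inv\<^bsub>add_monoid (poly_ring n)\<^esub> x \<in> ?J"
        using x by (simp add: a_inv_def)
    qed
    have "q * p \<in> ?J" if "p \<in> ?J" "q \<in> polys n" for p q
    proof -
      have "a + b \<in> multiples n T" if "a \<in> Poly_Mapping.keys q" "b \<in> Poly_Mapping.keys p" for a b
        using that multiples_add[of b n T a] \<open>p \<in> ?J\<close> \<open>q \<in> polys n\<close>
        by (auto simp: polys_iff add.commute)
      then show ?thesis using Poly_Mapping.keys_mult[of q p] by blast
    qed
    then show "x \<otimes>\<^bsub>poly_ring n\<^esub> a \<in> ?J" "a \<otimes>\<^bsub>poly_ring n\<^esub> x \<in> ?J"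
      if "a \<in> ?J" "x \<in> polys n" for a x
      using that by (auto simp: mult.commute)
  qed
  moreover have "monomial_poly ` T \<subseteq> ?J"
    by (force simp: multiples_def mons_def)
  ultimately show "monomial_ideal n T \<subseteq> ?J"
    unfolding monomial_ideal_def by (intro genideal_minimal) auto
  interpret I: ideal "monomial_ideal n T :: 'k mpoly set" "poly_ring n"
    unfolding monomial_ideal_def by (rule genideal_ideal[OF sub])
  show "?J \<subseteq> monomial_ideal n T"
  proof
    fix p :: "'k mpoly" assume "p \<in> ?J"
    then have keys: "Poly_Mapping.keys p \<subseteq> multiples n T" by simp
    have single: "Poly_Mapping.single m c \<in> monomial_ideal n T" if "m \<in> multiples n T" for m and c :: 'k
    proof -
      obtain t m' where t: "t \<in> T" "m' \<in> mons n" "m = t + m'"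
        using \<open>m \<in> multiples n T\<close> by (auto simp: multiples_def)
      have "monomial_poly t \<in> (monomial_ideal n T :: 'k mpoly set)"
        unfolding monomial_ideal_def using genideal_self[OF sub] t(1) by auto
      moreover have "Poly_Mapping.single m' c \<in> polys n"
        using t(2) by (simp add: polys_iff)
      ultimately have "Poly_Mapping.single m' c * monomial_poly t \<in> (monomial_ideal n T :: 'k mpoly set)"
        using I.I_l_closed by fastforce
      then show ?thesis using t(3) by (simp add: monomial_poly_def mult_single add.commute)
    qed
    have "(\<Sum>m\<in>A. Poly_Mapping.single m (Poly_Mapping.lookup p m)) \<in> monomial_ideal n T"
      if "finite A" "A \<subseteq> Poly_Mapping.keys p" for A
      using that single keys I.zero_closed I.a_closed by (induction A rule: finite_induct) auto
    moreover have "p = (\<Sum>m\<in>Poly_Mapping.keys p. Poly_Mapping.single m (Poly_Mapping.lookup p m))"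
      by (rule poly_mapping_eqI) (simp add: lookup_sum lookup_single when_def in_keys_iff)
    ultimately show "p \<in> monomial_ideal n T" by (metis finite_keys order_refl)
  qed
qed

lemma monomial_poly_in_monomial_ideal:
  assumes "T \<subseteq> mons n"
  shows "monomial_poly m \<in> (monomial_ideal n T :: ('k::field) mpoly set) \<longleftrightarrow> m \<in> multiples n T"
  using assms by (simp add: monomial_ideal_eq)


section \<open>The Koszul complex\<close>

definition faces :: "nat \<Rightarrow> nat \<Rightarrow> nat set set" where
  "faces n p = {F. F \<subseteq> {1..n} \<and> card F = p}"

text \<open>A family c of polynomials stands for the chain \<Sum> c(F) e_F. The sign is that of x_i
  e_G in the differential of the basis element of \<open>insert i G\<close>. Faces of all sizes
  share one family, so statements select an exterior degree through \<open>faces\<close>.\<close>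

definition koszul_coeff :: "nat \<Rightarrow> nat set \<Rightarrow> ('k::field) mpoly" where
  "koszul_coeff i G = (-1) ^ card {g \<in> G. g < i} * var i"

definition koszul_bd :: "nat \<Rightarrow> (nat set \<Rightarrow> ('k::field) mpoly) \<Rightarrow> nat set \<Rightarrow> 'k mpoly" where
  "koszul_bd n c G = (\<Sum>i\<in>{1..n} - G. koszul_coeff i G * c (insert i G))"

lemma facesD: "F \<in> faces n p \<Longrightarrow> finite F \<and> F \<subseteq> {1..n} \<and> card F = p"
  unfolding faces_def using finite_subset by auto

lemma insert_in_faces: "G \<in> faces n p \<Longrightarrow> i \<in> {1..n} - G \<Longrightarrow> insert i G \<in> faces n (Suc p)"
  by (drule facesD) (simp add: faces_def)

lemma lookup_sign_mult:
  fixes p :: "('k::field) mpoly"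
  shows "Poly_Mapping.lookup ((-1) ^ e * p) m = (-1) ^ e * Poly_Mapping.lookup p m"
  by (cases "even e") auto

lemma lookup_koszul_coeff_mult:
  fixes p :: "('k::field) mpoly"
  shows "Poly_Mapping.lookup (koszul_coeff i G * p) m
    = (-1) ^ card {g \<in> G. g < i} * Poly_Mapping.lookup (var i * p) m"
  by (simp add: koszul_coeff_def mult.assoc lookup_sign_mult)

lemma keys_koszul_coeff_mult:
  fixes p :: "('k::field) mpoly"
  shows "Poly_Mapping.keys (koszul_coeff i G * p) \<subseteq> (\<lambda>m. m + xv i) ` Poly_Mapping.keys p"
  using keys_var_mult[of i p] by (auto simp: in_keys_iff lookup_koszul_coeff_mult)

lemma koszul_coeff_in_polys [simp]: "i \<in> {1..n} \<Longrightarrow> koszul_coeff i G \<in> polys n"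
  unfolding koszul_coeff_def by (intro polys_mult) auto

text \<open>Inserting the smaller index moves the larger one by one position, while inserting the
  larger leaves the smaller in place, so exactly one sign changes.\<close>

lemma koszul_coeff_swap:
  assumes "finite G" "i \<noteq> j" "i \<notin> G" "j \<notin> G"
  shows "koszul_coeff i G * koszul_coeff j (insert i G) = - (koszul_coeff j G * koszul_coeff i (insert j G) :: ('k::field) mpoly)"
proof -
  have *: "koszul_coeff i G * koszul_coeff j (insert i G) = - (koszul_coeff j G * koszul_coeff i (insert j G) :: 'k mpoly)"
    if "i < j" "i \<notin> G" for i j
  proof -
    have "{g \<in> insert i G. g < j} = insert i {g \<in> G. g < j}"
      and "{g \<in> insert j G. g < i} = {g \<in> G. g < i}"
      using that by auto
    then have "card {g \<in> insert i G. g < j} = Suc (card {g \<in> G. g < j})"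
      and "card {g \<in> insert j G. g < i} = card {g \<in> G. g < i}"
      using that assms(1) by simp_all
    then show ?thesis by (simp add: koszul_coeff_def mult_ac)
  qed
  from assms show ?thesis using *[of i j] *[of j i] by (cases "i < j") auto
qed

lemma koszul_bd_cong:
  "(\<And>i. i \<in> {1..n} - G \<Longrightarrow> c (insert i G) = c' (insert i G)) \<Longrightarrow> koszul_bd n c G = koszul_bd n c' G"
  unfolding koszul_bd_def by (rule sum.cong) auto

lemma koszul_bd_diff: "koszul_bd n (\<lambda>F. c F - c' F) G = koszul_bd n c G - koszul_bd n c' G"
  unfolding koszul_bd_def by (simp add: right_diff_distrib sum_subtractf)

text \<open>The double sum runs over ordered pairs of distinct indices outside \<open>G\<close>; the
  terms of (i, j) and (j, i) cancel by \<open>koszul_coeff_swap\<close>.\<close>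

lemma koszul_bd_bd:
  fixes c :: "nat set \<Rightarrow> ('k::field) mpoly"
  assumes "finite G"
  shows "koszul_bd n (koszul_bd n c) G = 0"
proof -
  define a where "a i j = koszul_coeff i G * (koszul_coeff j (insert i G) * c (insert j (insert i G)))" for i j
  define P where "P = {(i, j). i \<in> {1..n} - G \<and> j \<in> {1..n} - G \<and> i < j}"
  have fin: "finite P"
    by (rule finite_subset[of _ "{1..n} \<times> {1..n}"]) (auto simp: P_def)
  have "koszul_bd n (koszul_bd n c) G = (\<Sum>i\<in>{1..n} - G. \<Sum>j\<in>{1..n} - insert i G. a i j)"
    by (simp add: koszul_bd_def a_def sum_distrib_left)
  also have "\<dots> = (\<Sum>(i, j)\<in>(SIGMA i:{1..n} - G. {1..n} - insert i G). a i j)"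
    by (rule sum.Sigma) auto
  also have "(SIGMA i:{1..n} - G. {1..n} - insert i G) = P \<union> prod.swap ` P"
  proof (rule Set.set_eqI)
    fix x :: "nat \<times> nat"
    obtain i j where x: "x = (i, j)" by (cases x)
    have "x \<in> prod.swap ` P \<longleftrightarrow> (j, i) \<in> P" 
      using inj_image_mem_iff[OF inj_swap, of "(j, i)" P] by (simp add: x)
    moreover have "x \<in> (SIGMA i:{1..n} - G. {1..n} - insert i G) \<longleftrightarrow> (i, j) \<in> P \<or> (j, i) \<in> P"
      unfolding x P_def by (simp add: neq_iff) (meson linorder_neq_iff)
    ultimately show "x \<in> (SIGMA i:{1..n} - G. {1..n} - insert i G) \<longleftrightarrow> x \<in> P \<union> prod.swap ` P"
      unfolding x by blast
  qed
  also have "(\<Sum>(i, j)\<in>P \<union> prod.swap ` P. a i j)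
      = (\<Sum>(i, j)\<in>P. a i j) + (\<Sum>(i, j)\<in>prod.swap ` P. a i j)"
    using fin by (intro sum.union_disjoint) (auto simp: P_def)
  also have "(\<Sum>(i, j)\<in>prod.swap ` P. a i j) = (\<Sum>(i, j)\<in>P. a j i)"
    by (subst sum.reindex) (auto simp: case_prod_beta)
  also have "(\<Sum>(i, j)\<in>P. a j i) = (\<Sum>(i, j)\<in>P. - a i j)"
  proof (rule sum.cong[OF refl], clarify)
    fix i j assume "(i, j) \<in> P"
    then have "koszul_coeff j G * koszul_coeff i (insert j G) = - (koszul_coeff i G * koszul_coeff j (insert i G) :: 'k mpoly)"
      by (intro koszul_coeff_swap[OF assms]) (auto simp: P_def)
    then show "a j i = - a i j"
      unfolding a_def by (simp add: mult.assoc[symmetric] insert_commute)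
  qed
  finally show ?thesis by (simp add: sum_negf case_prod_beta)
qed

text \<open>
  A contraction of the Koszul complex which is homogeneous for the fine grading: in multidegree
  \<open>M\<close> it is exterior multiplication by \<open>e\<^sub>r\<close> divided by \<open>x\<^sub>r\<close>, where \<open>r\<close> is the first
  variable in the support of \<open>M\<close>.
\<close>

definition contraction :: "(nat set \<Rightarrow> ('k::field) mpoly) \<Rightarrow> nat set \<Rightarrow> 'k mpoly" where
  "contraction c F = Abs_poly_mapping (\<lambda>m. let r = Min (F \<union> Poly_Mapping.keys m) in
     if r \<in> F then Poly_Mapping.lookup (c (F - {r})) (m + xv r) else 0)"

text \<open>The point is finite support, which \<open>Abs_poly_mapping\<close> needs: a nonzero
  value at m comes from some r in F and a monomial m + x_r in the support of c(F - {r}), and these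
  determine m.\<close>

lemma lookup_contraction:
  assumes "finite F" "r = Min (F \<union> Poly_Mapping.keys m)"
  shows "Poly_Mapping.lookup (contraction c F) m =
    (if r \<in> F then Poly_Mapping.lookup (c (F - {r})) (m + xv r) else 0)"
proof -
  let ?f = "\<lambda>m. let r = Min (F \<union> Poly_Mapping.keys m) in
     if r \<in> F then Poly_Mapping.lookup (c (F - {r})) (m + xv r) else 0"
  have "{m. ?f m \<noteq> 0} \<subseteq> (\<Union>r\<in>F. (\<lambda>m. m - xv r) ` Poly_Mapping.keys (c (F - {r})))"
  proof
    fix m assume "m \<in> {m. ?f m \<noteq> 0}"
    then obtain r where r: "r \<in> F" "m + xv r \<in> Poly_Mapping.keys (c (F - {r}))"
      by (auto simp: Let_def in_keys_iff split: if_splits)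
    then show "m \<in> (\<Union>r\<in>F. (\<lambda>m. m - xv r) ` Poly_Mapping.keys (c (F - {r})))"
      by (intro UN_I[OF r(1)] image_eqI[OF _ r(2)]) simp
  qed
  then have "finite {m. ?f m \<noteq> 0}"
    by (rule finite_subset) (use assms in auto)
  then show ?thesis
    using assms by (simp add: contraction_def Let_def)
qed

lemma contraction_zero [simp]: "contraction (\<lambda>_. 0) F = 0"
  by (simp add: contraction_def Let_def cong: if_cong)

lemma contraction_in_polys:
  assumes "finite F" "\<And>F. c F \<in> polys n"
  shows "contraction c F \<in> polys n"
  unfolding polys_iff
proof
  fix m assume "m \<in> Poly_Mapping.keys (contraction c F)"
  then obtain r where "m + xv r \<in> Poly_Mapping.keys (c (F - {r}))"
    by (auto simp: in_keys_iff lookup_contraction[OF assms(1) refl] split: if_splits)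
  then have "m + xv r \<in> mons n" using assms(2) by (auto simp: polys_iff)
  then show "m \<in> mons n" by (simp only: mons_add_iff)
qed

text \<open>This is the homotopy identity \<partial>h + h\<partial> = id in one multidegree, with
  the term h\<partial> removed by \<open>cyc\<close>. The hypothesis \<open>ne\<close> excludes
  multidegree 0, where there is no variable x_r to contract with.\<close>

lemma contraction_homotopy:
  fixes c :: "nat set \<Rightarrow> ('k::field) mpoly"
  assumes F: "F \<subseteq> {1..n}" and m: "m \<in> mons n" and ne: "F \<noteq> {} \<or> m \<noteq> 0"
    and cyc: "\<And>r. r \<in> F \<Longrightarrow> koszul_bd n c (F - {r}) = 0"
  shows "Poly_Mapping.lookup (koszul_bd n (contraction c) F) m = Poly_Mapping.lookup (c F) m"
proof -
  have fin: "finite F" using F finite_subset by blast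
  define r where "r = Min (F \<union> Poly_Mapping.keys m)"
  have ne': "F \<union> Poly_Mapping.keys m \<noteq> {}"
    using ne by auto
  have r_in: "r \<in> F \<union> Poly_Mapping.keys m"
    using Min_in[OF _ ne'] fin by (simp add: r_def)
  have r_le: "r \<le> i" if "i \<in> F \<union> Poly_Mapping.keys m" for i
    using that fin by (simp add: r_def)
  have r1n: "r \<in> {1..n}"
    using r_in F m by (auto simp: mons_def)
  have sgn_r: "{g \<in> F'. g < r} = {}" if "F' \<subseteq> F" for F'
    using r_le that by (auto simp: not_less)
  define T where "T i = Poly_Mapping.lookup (koszul_coeff i F * contraction c (insert i F)) m" for i
  have T_0: "T i = 0" if "Poly_Mapping.lookup m i = 0" for i
    using that by (simp add: T_def lookup_koszul_coeff_mult lookup_var_mult_eq_0)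
  have T_add: "T i = (-1) ^ card {g \<in> F. g < i} *
      (if r \<in> insert i F then Poly_Mapping.lookup (c (insert i F - {r})) (m' + xv r) else 0)"
    if "m = m' + xv i" for i m'
  proof -
    \<comment> \<open>The choice of r depends only on the support of the multidegree, which does not
      change when x_i moves from the monomial into the face.\<close>
    have "r = Min (insert i F \<union> Poly_Mapping.keys m')"
      using that unfolding r_def by (simp add: keys_mon_add)
    then have "Poly_Mapping.lookup (contraction c (insert i F)) m' =
      (if r \<in> insert i F then Poly_Mapping.lookup (c (insert i F - {r})) (m' + xv r) else 0)"
      using fin by (intro lookup_contraction) auto
    then show ?thesis
      by (simp add: T_def lookup_koszul_coeff_mult that)
  qed
  have lhs: "Poly_Mapping.lookup (koszul_bd n (contraction c) F) m = (\<Sum>i\<in>{1..n} - F. T i)"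
    by (simp add: koszul_bd_def T_def lookup_sum)
  show ?thesis
  proof (cases "r \<in> F")
    case False
    then have "Poly_Mapping.lookup m r > 0"
      using r_in by (auto simp: in_keys_iff)
    then obtain m' where m': "m = m' + xv r" using ex_mon_sub_xv by blast
    \<comment> \<open>Since r is not in F, a nonzero summand requires r in
      \<open>insert i F\<close>, hence i = r.\<close>
    have "T i = 0" if "i \<in> {1..n} - F" "i \<noteq> r" for i
    proof (cases "Poly_Mapping.lookup m i = 0")
      case F': False
      then obtain m'' where "m = m'' + xv i" using ex_mon_sub_xv by blast
      then show ?thesis using T_add False that by auto
    qed (rule T_0)
    then have "(\<Sum>i\<in>{1..n} - F. T i) = (\<Sum>i\<in>{r}. T i)"
      using False r1n by (intro sum.mono_neutral_right) auto
    also have "\<dots> = Poly_Mapping.lookup (c F) m"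
      using T_add[OF m'] sgn_r[of F] False m' by simp
    finally show ?thesis using lhs by simp
  next
    case True
    \<comment> \<open>\<open>U i\<close> is the i-th summand of the boundary of \<open>c\<close> at
      F - {r}, which vanishes by \<open>cyc\<close>. Its r-th summand is the wanted coefficient, the
      others are the negatives of \<open>T i\<close>.\<close>
    define U where "U i = Poly_Mapping.lookup (koszul_coeff i (F - {r}) * c (insert i (F - {r}))) (m + xv r)" for i
    have U_r: "U r = Poly_Mapping.lookup (c F) m"
      unfolding U_def lookup_koszul_coeff_mult sgn_r[OF Diff_subset] using True by (simp add: insert_absorb)
    have U_i: "U i = - T i" if i: "i \<in> {1..n} - F" for i
    proof (cases "Poly_Mapping.lookup m i = 0")
      case 0: True
      then have "Poly_Mapping.lookup (m + xv r) i = 0"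
        using i True by (auto simp: lookup_add)
      then show ?thesis using T_0[OF 0]
        by (simp add: U_def lookup_koszul_coeff_mult lookup_var_mult_eq_0)
    next
      case False
      then obtain m' where m': "m = m' + xv i" using ex_mon_sub_xv by blast
      have "r \<le> i" "r \<noteq> i" using r_le[of i] False i True by (auto simp: in_keys_iff)
      then have "r < i" by simp
      then have split: "{g \<in> F. g < i} = insert r {g \<in> F - {r}. g < i}"
        using True by auto
      have sg: "card {g \<in> F. g < i} = Suc (card {g \<in> F - {r}. g < i})"
        unfolding split using fin by (intro card_insert_disjoint) auto
      have eq: "m + xv r = (m' + xv r) + xv i" "insert i (F - {r}) = insert i F - {r}"
        using m' \<open>r < i\<close> by (auto simp: ac_simps)
      show ?thesis
        unfolding U_def lookup_koszul_coeff_mult T_add[OF m'] sg eq using True by simp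
    qed
    have "0 = (\<Sum>i\<in>{1..n} - (F - {r}). U i)"
      using cyc[OF True] by (simp add: koszul_bd_def U_def lookup_sum[symmetric])
    also have "{1..n} - (F - {r}) = insert r ({1..n} - F)"
      using r1n by auto
    also have "(\<Sum>i\<in>insert r ({1..n} - F). U i) = U r + (\<Sum>i\<in>{1..n} - F. U i)"
      using True by simp
    also have "(\<Sum>i\<in>{1..n} - F. U i) = - (\<Sum>i\<in>{1..n} - F. T i)"
      using U_i by (simp add: sum_negf[symmetric])
    finally show ?thesis using lhs U_r by simp
  qed
qed

text \<open>Outside \<open>mons n\<close> all coefficients are 0, so only the constant coefficient
  at the empty face escapes the homotopy. Every boundary vanishes there, and \<open>const\<close>
  says the same of \<open>c\<close>.\<close>

lemma koszul_exact:
  fixes c :: "nat set \<Rightarrow> ('k::field) mpoly"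
  assumes F: "F \<subseteq> {1..n}" and c: "\<And>F. c F \<in> polys n"
    and cyc: "\<And>r. r \<in> F \<Longrightarrow> koszul_bd n c (F - {r}) = 0"
    and const: "F = {} \<Longrightarrow> Poly_Mapping.lookup (c {}) 0 = 0"
  shows "koszul_bd n (contraction c) F = c F"
proof (rule poly_mapping_eqI)
  fix m
  have fin: "finite F" using F finite_subset by blast
  have "koszul_bd n (contraction c) F \<in> polys n"
    unfolding koszul_bd_def using fin c by (intro polys_sum polys_mult contraction_in_polys) auto
  then have out: "Poly_Mapping.lookup (koszul_bd n (contraction c) F) m = Poly_Mapping.lookup (c F) m"
    if "m \<notin> mons n"
  proof -
    have "Poly_Mapping.lookup p m = 0" if "p \<in> polys n" for p :: "'k mpoly"
      using that \<open>m \<notin> mons n\<close> by (auto simp: polys_iff in_keys_iff)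
    then show ?thesis using \<open>koszul_bd n (contraction c) F \<in> polys n\<close> c[of F] by simp
  qed
  show "Poly_Mapping.lookup (koszul_bd n (contraction c) F) m = Poly_Mapping.lookup (c F) m"
  proof (cases "m \<in> mons n \<and> (F \<noteq> {} \<or> m \<noteq> 0)")
    case True
    then show ?thesis using contraction_homotopy[OF F _ _ cyc] by blast
  next
    case False
    then show ?thesis using out const
      by (auto simp: koszul_bd_def lookup_sum lookup_koszul_coeff_mult lookup_var_mult_eq_0)
  qed
qed

text \<open>Exactness at the empty face, where \<open>cyc\<close> is vacuous. A constant family can
  serve as the chain because \<open>contraction\<close> at a singleton reads only the value at the
  empty set.\<close>

lemma max_ideal_decomp:
  fixes p :: "('k::field) mpoly"
  assumes "p \<in> polys n" "Poly_Mapping.lookup p 0 = 0"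
  obtains q where "\<And>i. q i \<in> polys n" "p = (\<Sum>i\<in>{1..n}. var i * q i)"
proof
  show "contraction (\<lambda>_. p) {i} \<in> polys n" for i using assms by (intro contraction_in_polys) auto
  show "p = (\<Sum>i\<in>{1..n}. var i * contraction (\<lambda>_. p) {i})"
    using koszul_exact[of "{}" n "\<lambda>_. p"] assms by (simp add: koszul_bd_def koszul_coeff_def)
qed


section \<open>Linear resolutions\<close>

definition koszul_vbd :: "nat \<Rightarrow> (nat set \<Rightarrow> nat \<Rightarrow> ('k::field) mpoly) \<Rightarrow> nat set \<Rightarrow> nat \<Rightarrow> 'k mpoly" where
  "koszul_vbd n c G = (\<lambda>j. koszul_bd n (\<lambda>F. c F j) G)"

lemma koszul_vbd_eq_sum: "koszul_vbd n c G = (\<lambda>j. \<Sum>i\<in>{1..n} - G. koszul_coeff i G * c (insert i G) j)"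
  by (simp add: koszul_vbd_def koszul_bd_def)

lemma koszul_vbd_cong:
  assumes "G \<in> faces n p" "\<And>F. F \<in> faces n (Suc p) \<Longrightarrow> c F = c' F"
  shows "koszul_vbd n c G = koszul_vbd n c' G"
  unfolding koszul_vbd_def using assms by (intro ext koszul_bd_cong) (metis insert_in_faces)

lemma koszul_vbd_vbd: "finite G \<Longrightarrow> koszul_vbd n (koszul_vbd n c) G = (\<lambda>_. 0)"
  by (simp add: koszul_vbd_def koszul_bd_bd)

section \<open>Free modules and their graded homomorphisms\<close>

lemma free_mod_iff:
  "f \<in> free_mod n bs \<longleftrightarrow> (\<forall>j. f j \<in> polys n) \<and> (\<forall>j\<ge>length bs. f j = 0)"
  unfolding free_mod_def mem_Collect_eq by (metis not_le polys_zero)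

lemma free_mod_zero [simp]: "(\<lambda>_. 0) \<in> free_mod n bs"
  by (simp add: free_mod_iff)

lemma free_mod_mult: "p \<in> polys n \<Longrightarrow> f \<in> free_mod n bs \<Longrightarrow> (\<lambda>j. p * f j) \<in> free_mod n bs"
  by (auto simp: free_mod_iff intro: polys_mult)

lemma free_mod_sum:
  "(\<And>i. i \<in> A \<Longrightarrow> f i \<in> free_mod n bs) \<Longrightarrow> (\<lambda>j. \<Sum>i\<in>A. f i j) \<in> free_mod n bs"
  by (auto simp: free_mod_iff intro!: polys_sum sum.neutral)

lemma free_mod_koszul_vbd: "(\<And>F. c F \<in> free_mod n bs) \<Longrightarrow> koszul_vbd n c G \<in> free_mod n bs"
  unfolding koszul_vbd_eq_sum by (intro free_mod_sum free_mod_mult) auto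

lemma graded_homD:
  assumes "graded_hom n as bs \<phi>"
  shows "f \<in> free_mod n as \<Longrightarrow> \<phi> f \<in> free_mod n bs"
    and "f \<in> free_mod n as \<Longrightarrow> g \<in> free_mod n as \<Longrightarrow> \<phi> (\<lambda>j. f j + g j) = (\<lambda>j. \<phi> f j + \<phi> g j)"
    and "p \<in> polys n \<Longrightarrow> f \<in> free_mod n as \<Longrightarrow> \<phi> (\<lambda>j. p * f j) = (\<lambda>j. p * \<phi> f j)"
    and "f \<in> graded_part n as e \<Longrightarrow> \<phi> f \<in> graded_part n bs e"
  using assms unfolding graded_hom_def by blast+

lemma graded_hom_zero:
  assumes "graded_hom n as bs \<phi>"
  shows "\<phi> (\<lambda>_. 0) = (\<lambda>_. 0)"
  using graded_homD(3)[OF assms, of 0 "\<lambda>_. 0"] by simp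

lemma graded_hom_diff:
  assumes "graded_hom n as bs \<phi>" "f \<in> free_mod n as" "g \<in> free_mod n as"
  shows "\<phi> (\<lambda>j. f j - g j) = (\<lambda>j. \<phi> f j - \<phi> g j)"
  using graded_homD(2)[OF assms(1,2), of "\<lambda>j. - 1 * g j"] graded_homD(3)[OF assms(1) _ assms(3), of "- 1"]
    free_mod_mult[OF _ assms(3), of "- 1"] by simp

lemma graded_hom_sum:
  assumes "graded_hom n as bs \<phi>" "finite A"
    and "\<And>i. i \<in> A \<Longrightarrow> p i \<in> polys n" "\<And>i. i \<in> A \<Longrightarrow> f i \<in> free_mod n as"
  shows "\<phi> (\<lambda>j. \<Sum>i\<in>A. p i * f i j) = (\<lambda>j. \<Sum>i\<in>A. p i * \<phi> (f i) j)"
  using assms(2-)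
proof (induction A rule: finite_induct)
  case empty
  then show ?case using graded_hom_zero[OF assms(1)] by simp
next
  case (insert i A)
  have "(\<lambda>j. \<Sum>i\<in>A. p i * f i j) \<in> free_mod n as"
    using insert by (intro free_mod_sum free_mod_mult) auto
  then show ?case
    using insert graded_homD(2)[OF assms(1) free_mod_mult[of "p i" n "f i"]]
      graded_homD(3)[OF assms(1), of "p i" "f i"] by simp
qed

text \<open>Linearity of \<open>\<phi>\<close> makes the Koszul differential and the differential of
  the resolution commute, as in a double complex.\<close>

lemma graded_hom_koszul_vbd:
  assumes "graded_hom n as bs \<phi>" "\<And>F. c F \<in> free_mod n as"
  shows "\<phi> (koszul_vbd n c G) = koszul_vbd n (\<lambda>F. \<phi> (c F)) G"
  unfolding koszul_vbd_eq_sum using assms by (intro graded_hom_sum) auto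

text \<open>
  If two lifts \<open>c\<close> and \<open>b\<close> of a cycle and of zero have the same boundary, then exactness of
  the Koszul complex of a free module turns \<open>c - b\<close> into a boundary.
\<close>

lemma koszul_lift:
  fixes c b :: "nat set \<Rightarrow> nat \<Rightarrow> ('k::field) mpoly"
  assumes hom: "graded_hom n as bs \<phi>"
    and c: "\<And>F. c F \<in> free_mod n as" and b: "\<And>F. b F \<in> free_mod n as"
    and b0: "\<And>F. F \<in> faces n p \<Longrightarrow> \<phi> (b F) = (\<lambda>_. 0)"
    and cb: "\<And>G. G \<subseteq> {1..n} \<Longrightarrow> Suc (card G) = p \<Longrightarrow> koszul_vbd n c G = koszul_vbd n b G"
    and const: "\<And>j. p = 0 \<Longrightarrow> Poly_Mapping.lookup (c {} j) 0 = Poly_Mapping.lookup (b {} j) 0"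
  obtains a where "\<And>F. a F \<in> free_mod n as" "\<And>F. F \<in> faces n p \<Longrightarrow> \<phi> (c F) = koszul_vbd n (\<lambda>F. \<phi> (a F)) F"
proof
  \<comment> \<open>\<open>contraction_in_polys\<close> covers finite faces; the value 0 elsewhere
    keeps every \<open>a F\<close> in the free module.\<close>
  define a where "a F = (if F \<subseteq> {1..n} then (\<lambda>j. contraction (\<lambda>F. c F j - b F j) F) else (\<lambda>_. 0))" for F
  show a: "a F \<in> free_mod n as" for F
    using c b finite_subset[of F "{1..n}"]
    by (auto simp: a_def free_mod_iff intro!: contraction_in_polys polys_diff)
  fix F assume F: "F \<in> faces n p"
  have "koszul_vbd n a F j = c F j - b F j" for j
  proof -
    have "koszul_vbd n a F j = koszul_bd n (contraction (\<lambda>F. c F j - b F j)) F"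
      unfolding koszul_vbd_def by (rule koszul_bd_cong) (use facesD[OF F] in \<open>auto simp: a_def\<close>)
    also have "\<dots> = c F j - b F j"
    proof (rule koszul_exact)
      show "F \<subseteq> {1..n}" using facesD[OF F] by blast
      show "c F j - b F j \<in> polys n" for F
        using c b by (auto simp: free_mod_iff intro: polys_diff)
      show "Poly_Mapping.lookup (c {} j - b {} j) 0 = 0" if "F = {}"
        using F that const by (simp add: faces_def lookup_minus)
      fix r assume r: "r \<in> F"
      have "Suc (card (F - {r})) = p" using facesD[OF F] r by (metis card_Suc_Diff1)
      moreover have "F - {r} \<subseteq> {1..n}" using facesD[OF F] by blast
      ultimately have "koszul_vbd n c (F - {r}) j = koszul_vbd n b (F - {r}) j" using cb by metis
      then show "koszul_bd n (\<lambda>F. c F j - b F j) (F - {r}) = 0"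
        by (simp add: koszul_bd_diff koszul_vbd_def)
    qed
    finally show ?thesis .
  qed
  then have "koszul_vbd n a F = (\<lambda>j. c F j - b F j)" by (rule ext)
  then have "(\<lambda>j. \<phi> (c F) j - \<phi> (b F) j) = koszul_vbd n (\<lambda>F. \<phi> (a F)) F"
    using graded_hom_koszul_vbd[where c = a and G = F, OF hom a] graded_hom_diff[OF hom c[of F] b[of F]] by simp
  then show "\<phi> (c F) = koszul_vbd n (\<lambda>F. \<phi> (a F)) F"
    using b0[OF F] by simp
qed

lemma max_ideal_mod_iff:
  fixes f :: "nat \<Rightarrow> ('k::field) mpoly"
  shows "f \<in> max_ideal_mod n bs \<longleftrightarrow> f \<in> free_mod n bs \<and> (\<forall>j. \<forall>m\<in>Poly_Mapping.keys (f j). 1 \<le> mdeg m)"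
proof -
  have "Poly_Mapping.lookup p 0 = 0 \<longleftrightarrow> (\<forall>m\<in>Poly_Mapping.keys p. 1 \<le> mdeg m)" for p :: "'k mpoly"
    by (metis in_keys_iff mdeg_eq_0_iff less_one not_le)
  then show ?thesis by (simp add: max_ideal_mod_def)
qed

text \<open>One order of vanishing comes from the coefficients, the other from the variable in
  \<open>koszul_coeff\<close>.\<close>

lemma koszul_vbd_order:
  fixes c :: "nat set \<Rightarrow> nat \<Rightarrow> ('k::field) mpoly"
  assumes "\<And>F. c F \<in> max_ideal_mod n bs" "m \<in> Poly_Mapping.keys (koszul_vbd n c G j)"
  shows "2 \<le> mdeg m"
proof -
  obtain i where "m \<in> Poly_Mapping.keys (koszul_coeff i G * c (insert i G) j)"
    using assms(2) keys_sum[of "\<lambda>i. koszul_coeff i G * c (insert i G) j" "{1..n} - G"]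
    unfolding koszul_vbd_eq_sum by blast
  then obtain m' where "m = m' + xv i" "m' \<in> Poly_Mapping.keys (c (insert i G) j)"
    using keys_koszul_coeff_mult by blast
  moreover have "1 \<le> mdeg m'"
    using assms(1) calculation(2) by (auto simp: max_ideal_mod_iff)
  ultimately show ?thesis by (simp add: mdeg_add)
qed

section \<open>Koszul cycles over a linear resolution\<close>

context
  fixes n d :: nat and I :: "('k::field) mpoly set"
    and bs :: "nat \<Rightarrow> nat list" and \<epsilon> :: "(nat \<Rightarrow> 'k mpoly) \<Rightarrow> (nat \<Rightarrow> 'k mpoly)"
    and \<phi> :: "nat \<Rightarrow> (nat \<Rightarrow> 'k mpoly) \<Rightarrow> (nat \<Rightarrow> 'k mpoly)"
  assumes res: "min_graded_free_res n I bs \<epsilon> \<phi>"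
    and lin: "\<And>i b. b \<in> set (bs i) \<Longrightarrow> b = d + i"
begin

abbreviation "FM i \<equiv> free_mod n (bs i) :: (nat \<Rightarrow> 'k mpoly) set"

lemma res_hom: "graded_hom n (bs (Suc i)) (bs i) (\<phi> i)"
  and res_hom_eps: "graded_hom n (bs 0) [0] \<epsilon>"
  and res_im_eps: "\<epsilon> ` FM 0 = {f \<in> free_mod n [0]. f 0 \<in> I}"
  and res_ker_eps: "\<phi> 0 ` FM 1 = {f \<in> FM 0. \<epsilon> f = (\<lambda>_. 0)}"
  and res_ker_phi: "\<phi> (Suc i) ` FM (Suc (Suc i)) = {f \<in> FM (Suc i). \<phi> i f = (\<lambda>_. 0)}"
  and res_minimal: "\<phi> i ` FM (Suc i) \<subseteq> max_ideal_mod n (bs i)"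
  using res unfolding min_graded_free_res_def by auto

text \<open>
  The syzygy module in homological degree \<open>i\<close> is generated by linear forms, so what vanishes to
  order 2 in it comes from \<open>\<mm>F\<close>.
\<close>

lemma lift_order:
  assumes g: "g \<in> \<phi> i ` FM (Suc i)"
    and ord: "\<And>j m. m \<in> Poly_Mapping.keys (g j) \<Longrightarrow> 2 \<le> mdeg m"
  obtains h where "h \<in> max_ideal_mod n (bs (Suc i))" "\<phi> i h = g"
proof -
  from g obtain f where f: "f \<in> FM (Suc i)" "\<phi> i f = g" by auto
  \<comment> \<open>\<open>f0\<close> is the constant part of the preimage. The basis degrees are d
    + i + 1 in the source and d + i in the target, so the coordinates of its image are linear
    forms.\<close>
  define f0 :: "nat \<Rightarrow> 'k mpoly" where "f0 j = Poly_Mapping.single 0 (Poly_Mapping.lookup (f j) 0)" for j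
  define h where "h j = f j - f0 j" for j
  have keys_f0: "Poly_Mapping.keys (f0 j) \<subseteq> {0}" for j
    by (auto simp: f0_def)
  have f0: "f0 \<in> FM (Suc i)"
    using f(1) unfolding free_mod_iff by (auto simp: f0_def polys_iff mons_def)
  have h: "h \<in> FM (Suc i)"
    using f f0 by (auto simp: free_mod_iff h_def intro!: polys_diff)
  have h_const: "Poly_Mapping.lookup (h j) 0 = 0" for j
    by (simp add: h_def f0_def lookup_minus)
  have "f0 \<in> graded_part n (bs (Suc i)) (d + Suc i)"
    using f0 keys_f0 lin[of _ "Suc i"] unfolding graded_part_def
    by (fastforce simp: mdeg_def dest: nth_mem)
  then have g0: "\<phi> i f0 \<in> graded_part n (bs i) (d + Suc i)"
    using graded_homD(4)[OF res_hom] by blast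
  have g0_deg: "mdeg m = 1" if "m \<in> Poly_Mapping.keys (\<phi> i f0 j)" for j m
  proof (cases "j < length (bs i)")
    case True
    then have "mdeg m + bs i ! j = d + Suc i" using g0 that by (auto simp: graded_part_def)
    moreover have "bs i ! j = d + i" using True lin nth_mem by blast
    ultimately show ?thesis by simp
  next
    case False
    then show ?thesis using g0 that by (auto simp: graded_part_def free_mod_iff)
  qed
  \<comment> \<open>The remainder \<open>h\<close> has no constant term and splits over the
    variables. Quotients beyond the rank are set to 0 so that \<open>\<phi> i\<close> can be applied
    to each of the vectors they form.\<close>
  have ex_q: "\<exists>q. (\<forall>k. q k \<in> polys n) \<and> (j \<ge> length (bs (Suc i)) \<longrightarrow> (\<forall>k. q k = 0)) \<and> h j = (\<Sum>k\<in>{1..n}. var k * q k)" for j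
  proof (cases "j \<ge> length (bs (Suc i))")
    case True
    then show ?thesis using h by (intro exI[of _ "\<lambda>_. 0"]) (auto simp: free_mod_iff)
  next
    case False
    then show ?thesis
      using max_ideal_decomp[of "h j" n] h h_const by (metis free_mod_iff)
  qed
  from choice[OF allI, OF ex_q] obtain q where
    "\<forall>j. (\<forall>k. q j k \<in> polys n) \<and> (j \<ge> length (bs (Suc i)) \<longrightarrow> (\<forall>k. q j k = 0)) \<and> h j = (\<Sum>k\<in>{1..n}. var k * q j k)"
    ..
  then have q: "\<And>j k. q j k \<in> polys n" "\<And>j k. j \<ge> length (bs (Suc i)) \<Longrightarrow> q j k = 0"
    "\<And>j. h j = (\<Sum>k\<in>{1..n}. var k * q j k)" by blast+
  have q_free: "(\<lambda>j. q j k) \<in> FM (Suc i)" for k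
    using q by (simp add: free_mod_iff)
  have "\<phi> i h = (\<lambda>j. \<Sum>k\<in>{1..n}. var k * \<phi> i (\<lambda>j. q j k) j)"
    unfolding q(3)[abs_def] using q_free by (intro graded_hom_sum[OF res_hom]) auto
  have h_ord: "2 \<le> mdeg m" if m: "m \<in> Poly_Mapping.keys (\<phi> i h j)" for j m
  proof -
    have "m \<in> Poly_Mapping.keys (\<Sum>k\<in>{1..n}. var k * \<phi> i (\<lambda>j. q j k) j)"
      using m \<open>\<phi> i h = _\<close> by simp
    then obtain k where "m \<in> Poly_Mapping.keys (var k * \<phi> i (\<lambda>j. q j k) j)"
      using keys_sum[of "\<lambda>k. var k * \<phi> i (\<lambda>j. q j k) j" "{1..n}"] by blast
    then obtain m' where m': "m = m' + xv k" "m' \<in> Poly_Mapping.keys (\<phi> i (\<lambda>j. q j k) j)"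
      using keys_var_mult by blast
    moreover have "\<phi> i (\<lambda>j. q j k) \<in> max_ideal_mod n (bs i)"
      using res_minimal q_free by blast
    ultimately show ?thesis by (auto simp: max_ideal_mod_iff mdeg_add)
  qed
  have h_eq: "\<phi> i h = (\<lambda>j. g j - \<phi> i f0 j)"
    using graded_hom_diff[OF res_hom f(1) f0] f(2) unfolding h_def by simp
  \<comment> \<open>A monomial here would have degree 1, whereas \<open>g\<close> and, by
    minimality, \<open>\<phi> i h\<close> contain only monomials of degree at least 2.\<close>
  have "\<phi> i f0 j = 0" for j
  proof (rule ccontr)
    assume "\<phi> i f0 j \<noteq> 0"
    then obtain m where m: "m \<in> Poly_Mapping.keys (\<phi> i f0 j)" by fastforce
    have "Poly_Mapping.lookup (g j) m - Poly_Mapping.lookup (\<phi> i f0 j) m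
        = Poly_Mapping.lookup (\<phi> i h j) m"
      by (simp add: h_eq lookup_minus)
    moreover have "m \<notin> Poly_Mapping.keys (g j)" "m \<notin> Poly_Mapping.keys (\<phi> i h j)"
      using ord[of m j] h_ord[of m j] g0_deg[OF m] by auto
    ultimately show False using m by (simp add: in_keys_iff)
  qed
  then have "\<phi> i h = g" using h_eq by simp
  moreover have "h \<in> max_ideal_mod n (bs (Suc i))"
    using h h_const by (simp add: max_ideal_mod_def)
  ultimately show ?thesis using that by blast
qed

text \<open>The coefficients lift to \<open>h\<close> in \<mm>F. The Koszul boundary of
  \<open>h\<close> lies in the next syzygy module and again has order 2, so induction, with
  \<open>p\<close> lowered and \<open>i\<close> raised, writes it as the boundary of some
  \<open>b\<close>. Then \<open>h - b\<close> is a Koszul cycle in a free module and has the same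
  image as \<open>h\<close>.\<close>

lemma koszul_acyclic:
  assumes "\<And>F. c F \<in> \<phi> i ` FM (Suc i)"
    and "\<And>F j m. m \<in> Poly_Mapping.keys (c F j) \<Longrightarrow> 2 \<le> mdeg m"
    and "\<And>G. G \<subseteq> {1..n} \<Longrightarrow> Suc (card G) = p \<Longrightarrow> koszul_vbd n c G = (\<lambda>_. 0)"
  shows "\<exists>a. (\<forall>F. a F \<in> \<phi> i ` FM (Suc i)) \<and> (\<forall>F\<in>faces n p. c F = koszul_vbd n a F)"
  using assms
proof (induction p arbitrary: c i)
  case (0 c i)
  have "\<exists>h. h \<in> max_ideal_mod n (bs (Suc i)) \<and> \<phi> i h = c F" for F
    by (rule lift_order[of "c F" i]) (use 0(1,2) in blast)+
  then obtain h where h: "\<And>F. h F \<in> max_ideal_mod n (bs (Suc i))" "\<And>F. \<phi> i (h F) = c F"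
    by metis
  obtain a where "\<And>F. a F \<in> FM (Suc i)" "\<And>F. F \<in> faces n 0 \<Longrightarrow> \<phi> i (h F) = koszul_vbd n (\<lambda>F. \<phi> i (a F)) F"
  proof (rule koszul_lift[OF res_hom, where c = h and b = "\<lambda>_ _. 0" and p = 0])
    show "h F \<in> FM (Suc i)" for F using h(1) by (simp add: max_ideal_mod_iff)
    show "Poly_Mapping.lookup (h {} j) 0 = Poly_Mapping.lookup 0 0" for j
      using h(1) by (simp add: max_ideal_mod_def)
    show "\<phi> i (\<lambda>_. 0) = (\<lambda>_. 0)" by (rule graded_hom_zero[OF res_hom])
  qed auto
  then show ?case using h(2) by (intro exI[of _ "\<lambda>F. \<phi> i (a F)"]) auto
next
  case (Suc p c i)
  have "\<exists>h. h \<in> max_ideal_mod n (bs (Suc i)) \<and> \<phi> i h = c F" for F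
    by (rule lift_order[of "c F" i]) (use Suc.prems(1,2) in blast)+
  then obtain h where h: "\<And>F. h F \<in> max_ideal_mod n (bs (Suc i))" "\<And>F. \<phi> i (h F) = c F"
    by metis
  have h_free: "h F \<in> FM (Suc i)" for F using h(1) by (simp add: max_ideal_mod_iff)
  \<comment> \<open>The induction hypothesis constrains all sets, but \<open>\<phi> i\<close> is
    only known to kill the boundary of \<open>h\<close> on faces of size \<open>p\<close>; elsewhere
    it is cut off to 0.\<close>
  define c' where "c' G = (if G \<in> faces n p then koszul_vbd n h G else (\<lambda>_. 0))" for G
  have "\<exists>b. (\<forall>F. b F \<in> \<phi> (Suc i) ` FM (Suc (Suc i))) \<and> (\<forall>F\<in>faces n p. c' F = koszul_vbd n b F)"
  proof (rule Suc.IH)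
    fix G
    show "c' G \<in> \<phi> (Suc i) ` FM (Suc (Suc i))"
    proof (cases "G \<in> faces n p")
      case True
      then have "koszul_vbd n c G = (\<lambda>_. 0)"
        by (intro Suc.prems(3)) (auto simp: faces_def)
      then have "\<phi> i (koszul_vbd n h G) = (\<lambda>_. 0)"
        using graded_hom_koszul_vbd[where c = h and G = G, OF res_hom h_free] h(2) by simp
      then show ?thesis
        using True free_mod_koszul_vbd[OF h_free] unfolding res_ker_phi c'_def by simp
    next
      case False
      then show ?thesis using graded_hom_zero[OF res_hom, of i] unfolding res_ker_phi c'_def by simp
    qed
    show "2 \<le> mdeg m" if "m \<in> Poly_Mapping.keys (c' G j)" for j m
      using that koszul_vbd_order[OF h(1)] by (auto simp: c'_def split: if_splits)
    assume G: "G \<subseteq> {1..n}" "Suc (card G) = p"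
    then have "koszul_vbd n c' G = koszul_vbd n (koszul_vbd n h) G"
      by (intro koszul_vbd_cong[where p = "card G"]) (auto simp: c'_def faces_def)
    also have "\<dots> = (\<lambda>_. 0)"
      using G finite_subset by (intro koszul_vbd_vbd) blast
    finally show "koszul_vbd n c' G = (\<lambda>_. 0)" .
  qed
  then obtain b where b: "\<And>F. b F \<in> \<phi> (Suc i) ` FM (Suc (Suc i))"
    "\<And>F. F \<in> faces n p \<Longrightarrow> c' F = koszul_vbd n b F" by blast
  have b': "b F \<in> FM (Suc i)" "\<phi> i (b F) = (\<lambda>_. 0)" for F
    using b(1)[of F] unfolding res_ker_phi by auto
  obtain a where "\<And>F. a F \<in> FM (Suc i)"
    "\<And>F. F \<in> faces n (Suc p) \<Longrightarrow> \<phi> i (h F) = koszul_vbd n (\<lambda>F. \<phi> i (a F)) F"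
  proof (rule koszul_lift[OF res_hom h_free b'])
    fix G assume "G \<subseteq> {1..n}" "Suc (card G) = Suc p"
    then have "G \<in> faces n p" by (simp add: faces_def)
    then show "koszul_vbd n h G = koszul_vbd n b G" using b(2)[of G] by (simp add: c'_def)
  qed auto
  then show ?case using h(2) by (intro exI[of _ "\<lambda>F. \<phi> i (a F)"]) auto
qed

text \<open>
  The Koszul chain \<open>f e\<^sub>2\<^sub>\<dots>\<^sub>n\<close> has its boundary in \<open>I\<close>; this cycle of \<open>I\<close> must be a boundary.
\<close>

lemma colon_by_tail_variables:
  assumes n: "3 \<le> n" and f: "f \<in> polys n" and I: "I \<subseteq> polys n"
    and soc: "\<And>k. k \<in> {2..n} \<Longrightarrow> \<exists>i\<in>{1..n}. \<exists>l\<in>I. var k * f = var i * l"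
  shows "\<exists>a\<in>I. \<forall>k\<in>{2..n}. \<exists>c\<in>I. var k * (f - a) = var 1 * c"
proof -
  define T where "T = {2..n}"
  \<comment> \<open>\<open>T\<close> has n - 1 elements. The cycle \<open>z\<close> is supported on
    its facets, of size n - 2 = \<open>Suc p\<close>, and the boundary of a lift of \<open>z\<close>
    is needed in size \<open>p\<close>.\<close>
  define p where "p = n - 3"
  have p: "n - 2 = Suc p" using n by (simp add: p_def)
  define c0 where "c0 F = (if F = T then (\<lambda>j. if j = 0 then f else 0) else (\<lambda>_::nat. 0))" for F
  define z where "z G = (if G \<in> faces n (Suc p) then koszul_vbd n c0 G else (\<lambda>_. 0))" for G
  have compl: "{1..n} - (T - {k}) = {1, k}" if "k \<in> T" for k
    using that n by (auto simp: T_def)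
  have face_k: "T - {k} \<in> faces n (Suc p)" if "k \<in> T" for k
    using that p by (auto simp: T_def faces_def)
  have koszul_vbd_k: "koszul_vbd n c (T - {k}) = (\<lambda>j. koszul_coeff 1 (T - {k}) * c (insert 1 (T - {k})) j + koszul_coeff k (T - {k}) * c T j)"
    if "k \<in> T" for k and c :: "nat set \<Rightarrow> nat \<Rightarrow> 'k mpoly"
  proof -
    have "1 \<noteq> k" "insert k (T - {k}) = T" using that by (auto simp: T_def)
    then show ?thesis using compl[OF that] by (simp add: koszul_vbd_eq_sum)
  qed
  have z_k: "z (T - {k}) = (\<lambda>j. if j = 0 then koszul_coeff k (T - {k}) * f else 0)" if "k \<in> T" for k
  proof -
    have "1 \<notin> T" by (simp add: T_def)
    then have "insert 1 (T - {k}) \<noteq> T" by blast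
    then show ?thesis using that by (auto simp: z_def face_k koszul_vbd_k c0_def)
  qed
  have z_other: "z G = (\<lambda>_. 0)" if G: "\<And>k. k \<in> T \<Longrightarrow> G \<noteq> T - {k}" for G
  proof (cases "G \<in> faces n (Suc p)")
    case True
    have "insert i G \<noteq> T" if "i \<in> {1..n} - G" for i
    proof
      assume "insert i G = T"
      then have "i \<in> T" "G = T - {i}" using that by auto
      then show False using G by blast
    qed
    then show ?thesis using True unfolding z_def koszul_vbd_eq_sum c0_def by simp
  qed (simp add: z_def)
  \<comment> \<open>\<open>lift_order\<close> concerns only the maps \<open>\<phi> i\<close>, so the
    lift along \<open>\<epsilon>\<close> is built directly: \<open>soc\<close> writes x_k f as x_i l
    with l in \<open>I\<close>, and x_i times a preimage of l has no constant term.\<close>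
  have "\<exists>h. h \<in> max_ideal_mod n (bs 0) \<and> \<epsilon> h = z G" for G
  proof (cases "\<exists>k\<in>T. G = T - {k}")
    case True
    then obtain k where k: "k \<in> T" "G = T - {k}" by blast
    obtain i l where il: "i \<in> {1..n}" "l \<in> I" "var k * f = var i * l"
      using soc[of k] k(1) by (auto simp: T_def)
    have "(\<lambda>j::nat. if j = 0 then l else 0) \<in> {f \<in> free_mod n [0]. f 0 \<in> I}"
      using il(2) I by (auto simp: free_mod_iff)
    then have "(\<lambda>j::nat. if j = 0 then l else 0) \<in> \<epsilon> ` FM 0"
      by (simp only: res_im_eps)
    then obtain e where e: "e \<in> FM 0" "(\<lambda>j. if j = 0 then l else 0) = \<epsilon> e"
      by (elim imageE) blast
    define s :: "'k mpoly" where "s = (-1) ^ card {g \<in> G. g < k}"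
    have s: "s * var i \<in> polys n" using il(1) by (auto simp: s_def intro: polys_mult)
    have "\<epsilon> (\<lambda>j. (s * var i) * e j) = z G"
      unfolding graded_homD(3)[OF res_hom_eps s e(1)] e(2)[symmetric] k(2) z_k[OF k(1)]
      using il(3) by (auto simp: koszul_coeff_def s_def k(2) mult.assoc)
    moreover have "(\<lambda>j. (s * var i) * e j) \<in> max_ideal_mod n (bs 0)"
      using free_mod_mult[OF s e(1)]
      by (simp add: max_ideal_mod_def s_def mult.assoc lookup_sign_mult lookup_var_mult_eq_0)
    ultimately show ?thesis by blast
  next
    case False
    then have "z G = (\<lambda>_. 0)" by (intro z_other) auto
    then show ?thesis using graded_hom_zero[OF res_hom_eps]
      by (intro exI[of _ "\<lambda>_. 0"]) (simp add: max_ideal_mod_def)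
  qed
  then obtain h where h: "\<And>G. h G \<in> max_ideal_mod n (bs 0)" "\<And>G. \<epsilon> (h G) = z G" by metis
  have h_free: "h F \<in> FM 0" for F using h(1) by (simp add: max_ideal_mod_iff)
  define c' where "c' G = (if G \<in> faces n p then koszul_vbd n h G else (\<lambda>_. 0))" for G
  have "\<exists>b. (\<forall>F. b F \<in> \<phi> 0 ` FM (Suc 0)) \<and> (\<forall>F\<in>faces n p. c' F = koszul_vbd n b F)"
  proof (rule koszul_acyclic)
    fix G
    show "c' G \<in> \<phi> 0 ` FM (Suc 0)"
    proof (cases "G \<in> faces n p")
      case True
      have "koszul_vbd n z G = koszul_vbd n (koszul_vbd n c0) G"
        using True by (rule koszul_vbd_cong) (simp add: z_def)
      also have "\<dots> = (\<lambda>_. 0)" using facesD[OF True] by (intro koszul_vbd_vbd) auto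
      finally have "\<epsilon> (koszul_vbd n h G) = (\<lambda>_. 0)"
        using graded_hom_koszul_vbd[where c = h and G = G, OF res_hom_eps h_free] h(2) by simp
      then show ?thesis
        using True free_mod_koszul_vbd[OF h_free] res_ker_eps by (simp add: c'_def)
    next
      case False
      then show ?thesis using graded_hom_zero[OF res_hom_eps] res_ker_eps by (simp add: c'_def)
    qed
    show "2 \<le> mdeg m" if "m \<in> Poly_Mapping.keys (c' G j)" for j m
      using that koszul_vbd_order[OF h(1)] by (auto simp: c'_def split: if_splits)
    assume G: "G \<subseteq> {1..n}" "Suc (card G) = p"
    then have "koszul_vbd n c' G = koszul_vbd n (koszul_vbd n h) G"
      by (intro koszul_vbd_cong[where p = "card G"]) (auto simp: c'_def faces_def)
    also have "\<dots> = (\<lambda>_. 0)"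
      using G finite_subset by (intro koszul_vbd_vbd) blast
    finally show "koszul_vbd n c' G = (\<lambda>_. 0)" .
  qed
  then obtain b where b: "\<And>F. b F \<in> \<phi> 0 ` FM (Suc 0)"
    "\<And>F. F \<in> faces n p \<Longrightarrow> c' F = koszul_vbd n b F" by blast
  have b': "b F \<in> FM 0" "\<epsilon> (b F) = (\<lambda>_. 0)" for F
    using b(1)[of F] res_ker_eps by auto
  obtain a where a: "\<And>F. a F \<in> FM 0"
    "\<And>F. F \<in> faces n (Suc p) \<Longrightarrow> \<epsilon> (h F) = koszul_vbd n (\<lambda>F. \<epsilon> (a F)) F"
  proof (rule koszul_lift[OF res_hom_eps h_free b'])
    fix G assume "G \<subseteq> {1..n}" "Suc (card G) = Suc p"
    then have "G \<in> faces n p" by (simp add: faces_def)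
    then show "koszul_vbd n h G = koszul_vbd n b G" using b(2)[of G] by (simp add: c'_def)
  qed auto
  \<comment> \<open>\<open>A\<close> is a chain with coefficients in \<open>I\<close> whose boundary
    agrees with \<open>z\<close> on faces of size n - 2.\<close>
  define A where "A F = \<epsilon> (a F) 0" for F
  have A: "A F \<in> I" for F
    using res_im_eps a(1)[of F] unfolding A_def by blast
  \<comment> \<open>Closure of \<open>I\<close> under negation is inherited from the image of
    \<open>\<epsilon>\<close>.\<close>
  have A_neg: "- A F \<in> I" for F
  proof -
    have "(\<lambda>j. - 1 * a F j) \<in> FM 0" using a(1) by (intro free_mod_mult) auto
    then have "\<epsilon> (\<lambda>j. - 1 * a F j) 0 \<in> I" using res_im_eps by blast
    then show ?thesis using graded_homD(3)[OF res_hom_eps _ a(1), of "-1" F] by (simp add: A_def)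
  qed
  show ?thesis
  proof (rule bexI[OF _ A[of T]], rule ballI)
    fix k assume "k \<in> {2..n}"
    then have k: "k \<in> T" by (simp add: T_def)
    let ?G = "T - {k}"
    define e where "e = card {g \<in> ?G. g < k}"
    have "{g \<in> ?G. g < 1} = {}" by (auto simp: T_def)
    then have koszul_coeff: "koszul_coeff 1 ?G = (var 1 :: 'k mpoly)" "koszul_coeff k ?G = (-1) ^ e * (var k :: 'k mpoly)"
      by (simp_all only: koszul_coeff_def e_def) simp
    have "koszul_vbd n (\<lambda>F. \<epsilon> (a F)) ?G 0 = z ?G 0"
      using a(2)[OF face_k[OF k]] h(2) by metis
    \<comment> \<open>Only \<open>T\<close> and the face with k replaced by 1 have
      \<open>T - {k}\<close> as a facet, so the boundary has two terms here.\<close>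
    then have eq: "(-1) ^ e * var k * f = var 1 * A (insert 1 ?G) + (-1) ^ e * var k * A T"
      unfolding koszul_vbd_k[OF k] z_k[OF k] koszul_coeff A_def by simp
    have sq: "(-1) ^ e * (-1) ^ e = (1 :: 'k mpoly)"
      by (simp add: power_mult_distrib[symmetric])
    have "var k * (f - A T) = (-1) ^ e * (-1) ^ e * (var k * (f - A T))"
      by (simp add: sq)
    also have "\<dots> = (-1) ^ e * (((-1) ^ e * var k * f) - (-1) ^ e * var k * A T)"
      by (simp add: algebra_simps)
    also have "\<dots> = var 1 * ((-1) ^ e * A (insert 1 ?G))"
      unfolding eq by (simp add: algebra_simps)
    finally have "var k * (f - A T) = var 1 * ((-1) ^ e * A (insert 1 ?G))" .
    moreover have "(-1) ^ e * A (insert 1 ?G) \<in> I"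
      using A A_neg by (cases "even e") auto
    ultimately show "\<exists>c\<in>I. var k * (f - A T) = var 1 * c" by blast
  qed
qed

end

lemma linear_resolution_tail_colon:
  fixes I :: "('k::field) mpoly set"
  assumes "has_linear_resolution n d I" "3 \<le> n" "f \<in> polys n" "I \<subseteq> polys n"
    and "\<And>k. k \<in> {2..n} \<Longrightarrow> \<exists>i\<in>{1..n}. \<exists>l\<in>I. var k * f = var i * l"
  shows "\<exists>a\<in>I. \<forall>k\<in>{2..n}. \<exists>c\<in>I. var k * (f - a) = var 1 * c"
proof -
  obtain bs \<epsilon> \<phi> where "min_graded_free_res n I bs \<epsilon> \<phi>" "\<And>i b. b \<in> set (bs i) \<Longrightarrow> b = d + i"
    using assms(1) unfolding has_linear_resolution_def by blast
  then show ?thesis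
    using assms(2-) by (rule colon_by_tail_variables)
qed


section \<open>Lexsegments\<close>

lemma xv_less: "i < j \<Longrightarrow> xv j < xv i"
  unfolding less_iff_lex by (intro exI[of _ i]) auto

lemma xv_le: "i \<le> j \<Longrightarrow> xv j \<le> xv i"
  using xv_less by (metis le_less)

lemma less_by_first:
  assumes "w \<in> mons n" "w' \<in> mons n" "Poly_Mapping.lookup w 1 < Poly_Mapping.lookup w' 1"
  shows "w < w'"
proof -
  \<comment> \<open>Exponent vectors are indexed from 0; position 0 is empty in
    \<open>mons n\<close>, so index 1 decides first.\<close>
  have "Poly_Mapping.lookup m 0 = 0" if "m \<in> mons n" for m
    using that by (auto simp: mons_def in_keys_iff)
  then show ?thesis
    using assms unfolding less_iff_lex by (intro exI[of _ 1]) auto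
qed

lemma first_mono:
  assumes "w \<in> mons n" "w' \<in> mons n" "w \<le> w'"
  shows "Poly_Mapping.lookup w 1 \<le> Poly_Mapping.lookup w' 1"
  using less_by_first[OF assms(2,1)] assms(3) by (meson leD leI)

lemma mdeg_1_xv:
  assumes "mdeg m = 1"
  obtains i where "m = xv i"
proof -
  have "m \<noteq> 0" using assms by (auto simp: mdeg_def)
  then obtain i where "i \<in> Poly_Mapping.keys m" by fastforce
  then obtain m' where m': "m = m' + xv i"
    using ex_mon_sub_xv[of m i] by (auto simp: in_keys_iff)
  then have "mdeg m' = 0" using assms by (simp add: mdeg_add)
  then show ?thesis using m' that by simp
qed

lemma mons_of_deg_cancel:
  assumes "w' + xv j = w + xv i" "w \<in> mons_of_deg n d" "i \<in> {1..n}"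
  shows "w' \<in> mons_of_deg n d" "j \<in> {1..n}"
proof -
  have "w' + xv j \<in> mons n" "mdeg (w' + xv j) = mdeg (w + xv i)"
    using assms by (auto simp: mons_add_iff mons_of_deg_def simp del: xv_in_mons intro: xv_in_mons[THEN iffD2])
  then show "w' \<in> mons_of_deg n d" "j \<in> {1..n}"
    using assms(2) by (auto simp: mons_add_iff mons_of_deg_def mdeg_add)
qed

lemma multiples_same_deg:
  assumes "T \<subseteq> mons_of_deg n d" "mdeg m = d"
  shows "m \<in> multiples n T \<longleftrightarrow> m \<in> T"
proof
  assume "m \<in> multiples n T"
  then obtain t m' where t: "t \<in> T" "m' \<in> mons n" "m = t + m'" by (auto simp: multiples_def)
  then have "mdeg m' = 0" using assms by (auto simp: mons_of_deg_def mdeg_add)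
  then show "m \<in> T" using t by simp
next
  assume "m \<in> T"
  then show "m \<in> multiples n T" unfolding multiples_def by (force simp: mons_def)
qed

lemma multiples_next_deg:
  assumes "T \<subseteq> mons_of_deg n d" "mdeg m = Suc d"
  shows "m \<in> multiples n T \<longleftrightarrow> (\<exists>t\<in>T. \<exists>i\<in>{1..n}. t + xv i = m)"
proof
  assume "m \<in> multiples n T"
  then obtain t m' where t: "t \<in> T" "m' \<in> mons n" "m = t + m'" by (auto simp: multiples_def)
  then have "mdeg m' = 1" using assms by (auto simp: mons_of_deg_def mdeg_add)
  then obtain i where "m' = xv i" by (rule mdeg_1_xv)
  then show "\<exists>t\<in>T. \<exists>i\<in>{1..n}. t + xv i = m"
    using t by (intro bexI[of _ t] bexI[of _ i]) auto
next
  assume "\<exists>t\<in>T. \<exists>i\<in>{1..n}. t + xv i = m"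
  then show "m \<in> multiples n T" unfolding multiples_def by force
qed

lemma lexsegment_subset: "lexsegment n d u v \<subseteq> mons_of_deg n d"
  by (auto simp: lexsegment_def)

text \<open>For the ordering \<open>\<prec>\<close>, this is \<open>set(w)\<close>, cf. \<open>lq_set_monomial\<close>.\<close>

definition quot_set :: "nat \<Rightarrow> nat \<Rightarrow> mon \<Rightarrow> mon \<Rightarrow> mon \<Rightarrow> nat set" where
  "quot_set n d u v w = {t \<in> {1..n}. \<exists>w'\<in>lexsegment n d u v. \<exists>i\<in>{1..n}. w' \<prec> w \<and> w' + xv i = w + xv t}"

text \<open>The equation encodes w' = x_t w / x_1 without subtraction; for t \<noteq> 1 it has a
  solution exactly when x_1 divides w.\<close>

definition swap_first :: "mon \<Rightarrow> mon \<Rightarrow> nat \<Rightarrow> bool" where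
  "swap_first v w t \<longleftrightarrow> (\<exists>w'. w' + xv 1 = w + xv t \<and> v \<le> w')"

definition swap_later :: "mon \<Rightarrow> mon \<Rightarrow> nat \<Rightarrow> bool" where
  "swap_later u w t \<longleftrightarrow> (\<exists>i w'. t < i \<and> w' + xv i = w + xv t \<and> w' \<le> u)"

lemma swap_first_prec:
  assumes w: "w \<in> lexsegment n d u v" and t: "t \<in> {2..n}"
    and w': "w' + xv 1 = w + xv t" "v \<le> w'"
  shows "w' \<in> lexsegment n d u v" "w' \<prec> w"
proof -
  have "w' + xv 1 < w + xv 1" unfolding w'(1) using t xv_less[of 1 t] by simp
  then have "w' < w" by simp
  moreover have "w' \<in> mons_of_deg n d"
    using w t by (intro mons_of_deg_cancel[OF w'(1)]) (auto simp: lexsegment_def)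
  ultimately show "w' \<in> lexsegment n d u v" using w w'(2) by (auto simp: lexsegment_def)
  have "Poly_Mapping.lookup (w' + xv 1) 1 = Poly_Mapping.lookup (w + xv t) 1" using w' by simp
  then show "w' \<prec> w" using t by (auto simp: prec_def lookup_add)
qed

text \<open>If w' = x_t w / x_i precedes w, either the exponent of x_1 drops, so i = 1, or it is
  unchanged and w' > w, so i > t. In the first case w' \<le> u is automatic, in the second w' \<ge>
  v, which leaves one bound each.\<close>

lemma quot_set_iff:
  assumes w: "w \<in> lexsegment n d u v"
  shows "t \<in> quot_set n d u v w \<longleftrightarrow> t \<in> {2..n} \<and> (swap_first v w t \<or> swap_later u w t)"
proof
  assume "t \<in> quot_set n d u v w"
  then obtain w' i where t: "t \<in> {1..n}" and w': "w' \<in> lexsegment n d u v" "w' \<prec> w"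
    and i: "i \<in> {1..n}" and eq: "w' + xv i = w + xv t"
    by (auto simp: quot_set_def)
  have ne: "i \<noteq> t" using eq w'(2) by (auto simp: prec_def)
  have l1: "Poly_Mapping.lookup (w' + xv i) 1 = Poly_Mapping.lookup (w + xv t) 1" using eq by simp
  have "t \<noteq> 1"
    using l1 ne w'(2) by (auto simp: prec_def lookup_add split: if_splits)
  with t have t2: "t \<in> {2..n}" by auto
  show "t \<in> {2..n} \<and> (swap_first v w t \<or> swap_later u w t)"
  proof (cases "i = 1")
    case True
    then have "swap_first v w t"
      using eq w'(1) unfolding swap_first_def by (auto simp: lexsegment_def)
    then show ?thesis using t2 by simp
  next
    case False
    then have "w < w'"
      using l1 w'(2) \<open>t \<noteq> 1\<close> by (simp add: prec_def lookup_add)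
    then have "w + xv i < w + xv t" using eq by (metis add_less_cancel_right)
    then have "t < i" using ne xv_less[of i t] by (meson add_less_cancel_left less_asym linorder_neqE_nat)
    then have "swap_later u w t"
      using eq w'(1) unfolding swap_later_def by (auto simp: lexsegment_def)
    then show ?thesis using t2 by simp
  qed
next
  assume R: "t \<in> {2..n} \<and> (swap_first v w t \<or> swap_later u w t)"
  then have t: "t \<in> {2..n}" by simp
  from R show "t \<in> quot_set n d u v w"
  proof (elim conjE disjE)
    assume "swap_first v w t"
    then obtain w' where w': "w' + xv 1 = w + xv t" "v \<le> w'" by (auto simp: swap_first_def)
    show ?thesis
      using swap_first_prec[OF w t w'] w' t unfolding quot_set_def by force
  next
    assume "swap_later u w t"
    then obtain i w' where w': "t < i" "w' + xv i = w + xv t" "w' \<le> u" by (auto simp: swap_later_def)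
    have i: "i \<in> {1..n}" "w' \<in> mons_of_deg n d"
      using w t mons_of_deg_cancel[OF w'(2)] by (auto simp: lexsegment_def)
    have "w + xv i < w' + xv i" unfolding w'(2) using xv_less[OF w'(1)] by simp
    then have "w < w'" by simp
    then have "w' \<in> lexsegment n d u v" using i w w'(3) by (auto simp: lexsegment_def)
    moreover have "Poly_Mapping.lookup (w' + xv i) 1 = Poly_Mapping.lookup (w + xv t) 1" using w' by simp
    then have "w' \<prec> w" using t w'(1) \<open>w < w'\<close> by (auto simp: prec_def lookup_add)
    ultimately show ?thesis using w'(2) i t unfolding quot_set_def by force
  qed
qed

text \<open>The linear resolution enters only through the hypothesis \<open>K\<close>.\<close>

lemma quot_set_mono:
  assumes K: "\<And>w t i. \<lbrakk>Poly_Mapping.lookup v 1 < Poly_Mapping.lookup u 1; w \<in> lexsegment n d u v;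
      2 \<le> t; t < i; 0 < Poly_Mapping.lookup w i\<rbrakk> \<Longrightarrow> swap_first v w t \<or> swap_later u w t"
    and u: "u \<in> mons n" and v: "v \<in> mons n"
    and w: "w \<in> lexsegment n d u v" and s: "s \<in> quot_set n d u v w"
    and y: "y \<in> lexsegment n d u v" and i: "i \<in> {1..n}" and y_eq: "y + xv i = w + xv s"
    and y_min: "\<And>w' j. \<lbrakk>w' \<in> lexsegment n d u v; j \<in> {1..n}; w' + xv j = w + xv s\<rbrakk> \<Longrightarrow> \<not> w' \<prec> y"
    and t: "t \<in> quot_set n d u v y"
  shows "t \<in> quot_set n d u v w"
proof -
  have mons: "m \<in> mons n" if "m \<in> lexsegment n d u v" for m
    using that by (auto simp: lexsegment_def mons_of_deg_def)
  have first: "Poly_Mapping.lookup v 1 \<le> Poly_Mapping.lookup m 1 \<and> Poly_Mapping.lookup m 1 \<le> Poly_Mapping.lookup u 1"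
    if "m \<in> lexsegment n d u v" for m
    using that mons[OF that] first_mono u v by (auto simp: lexsegment_def)
  have s2: "s \<in> {2..n}" using s quot_set_iff[OF w] by blast
  have t2: "t \<in> {2..n}" and t_y: "swap_first v y t \<or> swap_later u y t"
    using t quot_set_iff[OF y] by auto
  have lk: "Poly_Mapping.lookup y k + (if i = k then 1 else 0) = Poly_Mapping.lookup w k + (if s = k then 1 else 0)" for k
    using arg_cong[OF y_eq, of "\<lambda>m. Poly_Mapping.lookup m k"] by (simp add: lookup_add)
  \<comment> \<open>Otherwise y \<le> w with the same exponent of x_1, and the monomial
    \<open>w1\<close> witnessing s in set(w) would precede y.\<close>
  have cases_i: "i = 1 \<or> s < i"
  proof (rule ccontr)
    assume "\<not> (i = 1 \<or> s < i)"
    then have "i \<noteq> 1" "i \<le> s" by auto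
    then have "y + xv i \<le> w + xv i" unfolding y_eq using xv_le[of i s] by simp
    then have "y \<le> w" by simp
    moreover have "Poly_Mapping.lookup y 1 = Poly_Mapping.lookup w 1"
      using lk[of 1] \<open>i \<noteq> 1\<close> s2 by auto
    moreover obtain w1 j where "w1 \<in> lexsegment n d u v" "j \<in> {1..n}" "w1 \<prec> w" "w1 + xv j = w + xv s"
      using s by (auto simp: quot_set_def)
    ultimately show False using y_min[of w1 j] by (auto simp: prec_def)
  qed
  \<comment> \<open>Lowering the exponent of x_1 takes precedence in \<open>\<prec>\<close>, so the
    minimal y arises by dividing by x_1 whenever that gives a generator.\<close>
  have first_s: "i = 1" if "swap_first v w s"
  proof (rule ccontr)
    assume "i \<noteq> 1"
    obtain w' where w': "w' + xv 1 = w + xv s" "v \<le> w'" using \<open>swap_first v w s\<close> by (auto simp: swap_first_def)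
    have "Poly_Mapping.lookup w' 1 + 1 = Poly_Mapping.lookup w 1"
      using arg_cong[OF w'(1), of "\<lambda>m. Poly_Mapping.lookup m 1"] s2 by (auto simp: lookup_add)
    then have "w' \<prec> y" using lk[of 1] \<open>i \<noteq> 1\<close> s2 by (auto simp: prec_def)
    then show False using y_min[of w' 1] w' swap_first_prec[OF w s2 w'] s2 by auto
  qed
  have "swap_first v w t \<or> swap_later u w t"
  proof (cases "Poly_Mapping.lookup v 1 < Poly_Mapping.lookup u 1 \<and> (\<exists>k>t. 0 < Poly_Mapping.lookup w k)")
    case True
    then show ?thesis using K[OF _ w, of t] t2 by auto
  next
    case not_K: False
    from t_y show ?thesis
    proof
      assume "swap_first v y t"
      then obtain y' where y': "y' + xv 1 = y + xv t" "v \<le> y'" by (auto simp: swap_first_def)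
      have ly': "Poly_Mapping.lookup y' 1 + 1 = Poly_Mapping.lookup y 1"
        using arg_cong[OF y'(1), of "\<lambda>m. Poly_Mapping.lookup m 1"] t2 by (auto simp: lookup_add)
      have "y' \<in> lexsegment n d u v" by (rule swap_first_prec[OF y t2 y'])
      \<comment> \<open>The generators y and y' differ in the exponent of x_1, so u_1 > v_1; by
        \<open>not_K\<close> no variable after x_t then divides w.\<close>
      then have "Poly_Mapping.lookup v 1 < Poly_Mapping.lookup u 1"
        using first[of y] first[of y'] y ly' by simp
      then have w_0: "Poly_Mapping.lookup w k = 0" if "t < k" for k using not_K that by auto
      have "0 < Poly_Mapping.lookup w 1"
        using lk[of 1] ly' s2 by auto
      then obtain z where z: "w = z + xv 1" using ex_mon_sub_xv by blast
      from cases_i show ?thesis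
      proof
        assume "i = 1"
        then have "Poly_Mapping.lookup w 1 = Poly_Mapping.lookup y 1 + 1" using lk[of 1] s2 by auto
        \<comment> \<open>The exponent of x_1 drops by 2 from w to y' but only by 1 from w to x_t w
          / x_1, so the latter exceeds v already at x_1.\<close>
        then have "Poly_Mapping.lookup v 1 < Poly_Mapping.lookup (z + xv t) 1"
          using ly' first[OF \<open>y' \<in> _\<close>] z t2 by (auto simp: lookup_add)
        moreover have "z + xv t \<in> mons n" using mons[OF w] z t2 by (simp add: mons_add_iff)
        ultimately have "v \<le> z + xv t" using less_by_first[OF v] by (simp add: less_imp_le)
        moreover have "(z + xv t) + xv 1 = w + xv t" by (simp add: z ac_simps)
        ultimately show ?thesis unfolding swap_first_def by blast
      next
        assume "s < i"
        then have "0 < Poly_Mapping.lookup w i" using lk[of i] by auto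
        then have "i \<le> t" using w_0[of i] by (metis less_irrefl not_le)
        \<comment> \<open>This branch is contradictory: y' = x_s x_t w / (x_1 x_i) with i \<le> t
          gives x_s w / x_1 \<ge> y' \<ge> v, and then \<open>first_s\<close> forces i = 1.\<close>
        have "(y' + xv i) + xv 1 = (y + xv i) + xv t" using y'(1) by (metis add.assoc add.commute)
        also have "\<dots> = (z + xv s + xv t) + xv 1" unfolding y_eq z by (simp add: ac_simps)
        finally have "y' + xv i = z + xv s + xv t" by simp
        also have "\<dots> \<le> z + xv s + xv i" using xv_le[OF \<open>i \<le> t\<close>] by simp
        finally have "y' \<le> z + xv s" by simp
        then have "v \<le> z + xv s" using y'(2) by simp
        moreover have "(z + xv s) + xv 1 = w + xv s" by (simp add: z ac_simps)
        ultimately have "swap_first v w s" unfolding swap_first_def by blast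
        then show ?thesis using first_s \<open>s < i\<close> s2 by simp
      qed
    next
      assume "swap_later u y t"
      then obtain j y' where y': "t < j" "y' + xv j = y + xv t" "y' \<le> u" by (auto simp: swap_later_def)
      have "0 < Poly_Mapping.lookup y j"
        using arg_cong[OF y'(2), of "\<lambda>m. Poly_Mapping.lookup m j"] y'(1) by (auto simp: lookup_add)
      then have s_j: "s = j" if "Poly_Mapping.lookup w j = 0"
        using lk[of j] that by (auto split: if_splits)
      have sum: "(y' + xv i) + xv j = (w + xv t) + xv s"
        using y'(2) y_eq by (metis add.assoc add.commute)
      show ?thesis
      proof (cases "i = 1")
        case True
        then have w_1: "Poly_Mapping.lookup w 1 = Poly_Mapping.lookup y 1 + 1" using lk[of 1] s2 by auto
        then have "Poly_Mapping.lookup v 1 < Poly_Mapping.lookup u 1" using first[OF w] first[OF y] by simp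
        \<comment> \<open>As u_1 > v_1, \<open>not_K\<close> keeps x_j from dividing w, so the x_j
          in y is the new x_s. Now t < s makes x_t w / x_1 at least y.\<close>
        then have "s = j" using not_K y'(1) by (intro s_j) auto
        obtain z where z: "w = z + xv 1" using ex_mon_sub_xv[of w 1] w_1 by auto
        have "y + xv 1 = (z + xv s) + xv 1" using y_eq z True by (simp add: ac_simps)
        then have "y = z + xv s" by simp
        then have "v \<le> z + xv s" using y by (simp add: lexsegment_def)
        also have "\<dots> \<le> z + xv t" using xv_le[of t s] \<open>s = j\<close> y'(1) by simp
        finally have "v \<le> z + xv t" .
        moreover have "(z + xv t) + xv 1 = w + xv t" by (simp add: z ac_simps)
        ultimately show ?thesis unfolding swap_first_def by blast
      next
        case False
        then have "s < i" using cases_i by simp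
        show ?thesis
        proof (cases "Poly_Mapping.lookup w j = 0")
          case True
          then have "s = j" by (rule s_j)
          then have "y' + xv i = w + xv t" using sum by simp
          then show ?thesis
            using y' \<open>s < i\<close> \<open>s = j\<close> unfolding swap_later_def by (meson less_trans)
        next
          case False
          then obtain z where z: "w = z + xv j" using ex_mon_sub_xv[of w j] by auto
          have "(y' + xv i) + xv j = (z + xv t + xv s) + xv j" unfolding sum z by (simp add: ac_simps)
          then have "y' + xv i = z + xv t + xv s" by simp
          \<comment> \<open>Since s < i, replacing x_s by x_i shows x_t w / x_j \<le> y', so the
            bound by u passes from y to w.\<close>
          also have "\<dots> \<ge> z + xv t + xv i" using xv_le[of s i] \<open>s < i\<close> by simp
          finally have "z + xv t \<le> y'" by simp
          then have "z + xv t \<le> u" using y'(3) by simp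
          moreover have "(z + xv t) + xv j = w + xv t" by (simp add: z ac_simps)
          ultimately show ?thesis using y'(1) unfolding swap_later_def by blast
        qed
      qed
    qed
  qed
  then show ?thesis using quot_set_iff[OF w] t2 by blast
qed

text \<open>Supplies \<open>K\<close> of \<open>quot_set_mono\<close>. If both swaps failed, p = x_t
  w / x_i would be a monomial of degree d outside \<open>I\<close> whose products with x_2, ..., x_n
  lie in \<mm>I, and the resolution is tested on it.\<close>

lemma linear_resolution_swap:
  fixes I :: "('k::field) mpoly set"
  assumes u: "u \<in> mons_of_deg n d" and v: "v \<in> mons_of_deg n d" and uv: "u \<ge> v"
    and compl: "completely_lexsegment n d (lexsegment n d u v)"
    and I: "I = monomial_ideal n (lexsegment n d u v)"
    and lin: "has_linear_resolution n d I"
    and first: "Poly_Mapping.lookup v 1 < Poly_Mapping.lookup u 1"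
    and w: "w \<in> lexsegment n d u v" and t: "2 \<le> t" and ti: "t < i" and wi: "0 < Poly_Mapping.lookup w i"
  shows "swap_first v w t \<or> swap_later u w t"
proof (rule ccontr)
  assume "\<not> (swap_first v w t \<or> swap_later u w t)"
  then have nA: "\<And>w'. w' + xv 1 = w + xv t \<Longrightarrow> w' < v" and nB: "\<And>w' j. t < j \<Longrightarrow> w' + xv j = w + xv t \<Longrightarrow> u < w'"
    by (auto simp: swap_first_def swap_later_def not_le)
  let ?L = "lexsegment n d u v"
  have mons: "u \<in> mons n" "v \<in> mons n" "w \<in> mons n" and deg: "mdeg u = d" "mdeg v = d" "mdeg w = d"
    using u v w by (auto simp: lexsegment_def mons_of_deg_def)
  have "i \<in> Poly_Mapping.keys w" using wi by (simp add: in_keys_iff)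
  then have i: "i \<in> {1..n}" using mons(3) unfolding mons_def by blast
  then have tn: "t \<in> {1..n}" using t ti by auto
  obtain z where z: "w = z + xv i" using ex_mon_sub_xv[OF wi] by blast
  have "z + xv t \<in> mons n" "Poly_Mapping.lookup (z + xv t) 1 = Poly_Mapping.lookup w 1"
    using z mons tn t ti by (auto simp: mons_add_iff lookup_add)
  moreover have "u < z + xv t" using z by (intro nB[OF ti]) (simp add: ac_simps)
  \<comment> \<open>The monomial x_t w / x_i exceeds u but has the x_1-exponent of w. Hence u_1
    \<le> w_1, and as u_1 > v_1, the variable x_1 divides w.\<close>
  ultimately have w1u: "Poly_Mapping.lookup u 1 \<le> Poly_Mapping.lookup w 1"
    using first_mono[OF mons(1)] by (metis less_imp_le)
  then have "0 < Poly_Mapping.lookup z 1"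
    using first z ti t by (auto simp: lookup_add)
  then obtain h' where h': "z = h' + xv 1" using ex_mon_sub_xv by blast
  define h where "h = h' + xv t"
  define p where "p = h + xv 1"
  have w_eq: "w = h' + xv 1 + xv i" by (simp add: z h')
  have p_u: "u < p" using w_eq by (intro nB[OF ti]) (simp add: p_def h_def ac_simps)
  have hi_v: "h + xv i < v" using w_eq by (intro nA) (simp add: h_def ac_simps)
  have n1: "1 \<in> {1..n}" "n \<in> {1..n}" and n3: "3 \<le> n" using i t ti by auto
  have h': "h' \<in> mons n" "mdeg h' + 2 = d"
    using mons(3) deg(3) unfolding w_eq by (simp_all add: mons_add_iff mdeg_add)
  have p: "p \<in> mons n" "mdeg p = d"
    using h' n1 tn by (simp_all add: p_def h_def mons_add_iff mdeg_add)
  have hn: "mdeg (h + xv n) = d"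
    using h' by (simp add: h_def mdeg_add)
  have p_notin: "p \<notin> multiples n ?L"
    using p_u by (subst multiples_same_deg[OF lexsegment_subset p(2)]) (auto simp: lexsegment_def)
  have "h + xv n \<le> h + xv i" using xv_le[of i n] i by simp
  then have "h + xv n < v" using hi_v by (rule le_less_trans)
  then have hn_notin: "h + xv n \<notin> multiples n ?L"
    by (subst multiples_same_deg[OF lexsegment_subset hn]) (auto simp: lexsegment_def)
  have "Poly_Mapping.lookup p 1 = Poly_Mapping.lookup w 1"
    using t ti by (simp add: p_def h_def w_eq lookup_add)
  moreover have "Poly_Mapping.lookup w 1 \<le> Poly_Mapping.lookup u 1"
    using first_mono[OF mons(3,1)] w by (simp add: lexsegment_def)
  ultimately have p1: "Poly_Mapping.lookup p 1 = Poly_Mapping.lookup u 1" using w1u by simp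
  have ex: "\<exists>j\<in>{1..n}. \<exists>l\<in>I. var k * monomial_poly p = var j * l" if k: "k \<in> {2..n}" for k
  proof -
    have "is_lexsegment n (d + 1) ((shad n ^^ 1) ?L)"
      using compl unfolding completely_lexsegment_def by blast
    then obtain U V where UV: "shad n ?L = lexsegment n (d + 1) U V"
      by (auto simp: is_lexsegment_def)
    have in_shad: "m + xv j \<in> shad n ?L" if "m \<in> ?L" "j \<in> {1..n}" for m j
      using that unfolding shad_def xv_def by blast
    have uL: "u \<in> ?L" "v \<in> ?L" using u v uv by (auto simp: lexsegment_def)
    have "u + xv 1 \<le> U" "V \<le> v + xv n"
      using in_shad[OF uL(1) n1(1)] in_shad[OF uL(2) n1(2)] unfolding UV by (auto simp: lexsegment_def)
    moreover have kp: "p + xv k \<in> mons n" "mdeg (p + xv k) = d + 1"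
      using p k by (auto simp: mons_add_iff mdeg_add)
    \<comment> \<open>Both bounds are decided at x_1: there p x_k has exponent u_1, strictly between
      v_1 and u_1 + 1.\<close>
    moreover have "p + xv k < u + xv 1"
      using kp mons n1 p1 k by (intro less_by_first) (auto simp: mons_add_iff lookup_add)
    moreover have "v + xv n < p + xv k"
      using kp mons n1 n3 p1 k first by (intro less_by_first) (auto simp: mons_add_iff lookup_add)
    ultimately have "p + xv k \<in> lexsegment n (d + 1) U V"
      by (auto simp: lexsegment_def mons_of_deg_def)
    then have "p + xv k \<in> shad n ?L" by (simp only: UV)
    then obtain l j where l: "l \<in> ?L" "j \<in> {1..n}" "p + xv k = l + xv j"
      unfolding shad_def xv_def by blast
    have "monomial_poly l \<in> I"
      unfolding I using l(1) lexsegment_subset[of n d u v]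
      by (subst monomial_poly_in_monomial_ideal)
        (auto simp: multiples_same_deg[OF lexsegment_subset] mons_of_deg_def)
    moreover have "var k * monomial_poly p = (var j * monomial_poly l :: 'k mpoly)"
      using l(3) by (simp add: var_eq monomial_poly_add[symmetric] add.commute)
    ultimately show ?thesis using l(2) by blast
  qed
  have L_mons: "?L \<subseteq> mons n" by (auto simp: lexsegment_def mons_of_deg_def)
  have I_keys: "a \<in> I \<longleftrightarrow> Poly_Mapping.keys a \<subseteq> multiples n ?L" for a
    unfolding I by (simp add: monomial_ideal_eq[OF L_mons])
  have "multiples n ?L \<subseteq> mons n"
    using L_mons by (auto simp: multiples_def mons_add_iff)
  then have "I \<subseteq> polys n" using I_keys by (auto simp: polys_iff)
  then obtain a where a: "a \<in> I"
    "\<And>k. k \<in> {2..n} \<Longrightarrow> \<exists>c\<in>I. var k * (monomial_poly p - a) = var 1 * c"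
    using linear_resolution_tail_colon[OF lin n3, of "monomial_poly p"] p ex by auto
  from a(2)[of n] obtain c where c: "c \<in> I" "var n * (monomial_poly p - a) = var 1 * c"
    using n3 by auto
  \<comment> \<open>At the monomial p x_n = h x_1 x_n, one side gives the coefficient of p in p - a,
    the other that of h x_n in c, which is 0. As a has no term p, this would mean 1 = 0.\<close>
  have "Poly_Mapping.lookup (monomial_poly p - a) p = Poly_Mapping.lookup (var n * (monomial_poly p - a)) (p + xv n)"
    by simp
  also have "\<dots> = Poly_Mapping.lookup (var 1 * c) ((h + xv n) + xv 1)"
    unfolding c(2) by (simp add: p_def ac_simps)
  also have "\<dots> = Poly_Mapping.lookup c (h + xv n)" by (rule lookup_var_mult_add)
  also have "\<dots> = 0" using c(1) hn_notin unfolding I_keys by (auto simp: in_keys_iff)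
  finally have "Poly_Mapping.lookup (monomial_poly p :: 'k mpoly) p = Poly_Mapping.lookup a p"
    by (simp add: lookup_minus)
  moreover have "Poly_Mapping.lookup a p = 0"
    using a(1) p_notin unfolding I_keys by (auto simp: in_keys_iff)
  ultimately show False by (simp add: monomial_poly_def)
qed


section \<open>The decomposition function\<close>

lemma prec_asym: "w \<prec> w' \<Longrightarrow> \<not> w' \<prec> w"
  by (auto simp: prec_def)

lemma set_takeWhile_prec:
  assumes "sorted_wrt (\<prec>) us" "w \<in> set us"
  shows "set (takeWhile (\<lambda>x. x \<noteq> w) us) = {w' \<in> set us. w' \<prec> w}"
  using assms
proof (induction us)
  case (Cons a us)
  show ?case
  proof (cases "a = w")
    case True
    then show ?thesis using Cons.prems prec_asym by auto
  next
    case False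
    then show ?thesis using Cons by auto
  qed
qed simp

text \<open>Membership of the monomial x_t w means divisibility by an earlier generator, and since
  its degree is d + 1 the cofactor is a single variable.\<close>

lemma lq_set_monomial:
  assumes us: "set us = lexsegment n d u v" "sorted_wrt (\<prec>) us" and w: "w \<in> set us"
  shows "lq_set n (map monomial_poly us) (monomial_poly w :: ('k::field) mpoly) = quot_set n d u v w"
proof -
  let ?T = "{w' \<in> set us. w' \<prec> w}"
  have T: "?T \<subseteq> mons_of_deg n d" "?T \<subseteq> mons n" and deg: "mdeg w = d" "w \<in> mons n"
    using us(1) w by (auto simp: lexsegment_def mons_of_deg_def)
  have "set (takeWhile (\<lambda>x. x \<noteq> monomial_poly w) (map monomial_poly us)) = (monomial_poly ` ?T :: 'k mpoly set)"
    by (simp add: takeWhile_map o_def set_takeWhile_prec[OF us(2) w])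
  then have "lq_set n (map monomial_poly us) (monomial_poly w :: 'k mpoly)
      = {t \<in> {1..n}. var t * monomial_poly w \<in> (monomial_ideal n ?T :: 'k mpoly set)}"
    by (auto simp: lq_set_def colon_ideal_def monomial_ideal_def)
  also have "\<dots> = {t \<in> {1..n}. w + xv t \<in> multiples n ?T}"
    by (simp add: var_eq monomial_poly_add[symmetric] monomial_poly_in_monomial_ideal[OF T(2)] add.commute)
  also have "\<dots> = quot_set n d u v w"
  proof -
    have "w + xv t \<in> multiples n ?T \<longleftrightarrow> (\<exists>w'\<in>?T. \<exists>i\<in>{1..n}. w' + xv i = w + xv t)" for t
      using deg by (intro multiples_next_deg[OF T(1)]) (simp add: mdeg_add)
    then show ?thesis unfolding quot_set_def us(1) by auto
  qed
  finally show ?thesis .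
qed

text \<open>A monomial lies in I_j iff one of the first j generators divides it, so the least index
  selects the first generator dividing m.\<close>

lemma decomp_fun_monomial:
  assumes us: "set us \<subseteq> mons n" "sorted_wrt (\<prec>) us" and m: "m \<in> multiples n (set us)"
  obtains y where "y \<in> set us" "m \<in> multiples n {y}"
    "\<And>w'. \<lbrakk>w' \<in> set us; w' \<prec> y\<rbrakk> \<Longrightarrow> m \<notin> multiples n {w'}"
    "decomp_fun n (map monomial_poly us) (monomial_poly m) = (monomial_poly y :: ('k::field) mpoly)"
proof -
  define Q where "Q j \<longleftrightarrow> j < length us \<and> m \<in> multiples n (set (take (Suc j) us))" for j
  define j where "j = (LEAST j. Q j)"
  have Q_iff: "Q j \<longleftrightarrow> j < length us \<and> (\<exists>i\<le>j. m \<in> multiples n {us ! i})" for j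
    unfolding Q_def multiples_def by (fastforce simp: in_set_conv_nth less_Suc_eq_le)
  obtain i where i: "i < length us" "m \<in> multiples n {us ! i}"
    using m unfolding multiples_def by (fastforce simp: in_set_conv_nth)
  then have "Q i" unfolding Q_iff by blast
  then have Qj: "Q j" unfolding j_def by (rule LeastI)
  have least: "\<not> Q k" if "k < j" for k using that not_less_Least unfolding j_def by blast
  have jl: "j < length us" using Qj by (simp add: Q_def)
  show ?thesis
  proof (rule that)
    show "us ! j \<in> set us" using jl by simp
    obtain k where k: "k \<le> j" "m \<in> multiples n {us ! k}" using Qj unfolding Q_iff by blast
    then have "Q k" using jl unfolding Q_iff by auto
    then have "k = j" using least[of k] k(1) by (meson le_neq_implies_less)
    then show "m \<in> multiples n {us ! j}" using k by simp
    show "m \<notin> multiples n {w'}" if w': "w' \<in> set us" "w' \<prec> us ! j" for w'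
    proof
      assume mw: "m \<in> multiples n {w'}"
      obtain k where k: "k < length us" "w' = us ! k" using w'(1) by (auto simp: in_set_conv_nth)
      have "k < j"
      proof (rule ccontr)
        assume "\<not> k < j"
        then have "us ! j \<prec> us ! k \<or> us ! j = us ! k"
          using sorted_wrt_nth_less[OF us(2), of j k] k(1) by (cases "j = k") auto
        then show False using w'(2) k(2) prec_asym by auto
      qed
      moreover have "Q k" using k mw unfolding Q_iff by blast
      ultimately show False using least by blast
    qed
    have "monomial_poly m \<in> Idl\<^bsub>poly_ring n\<^esub> (set (take (Suc j) (map monomial_poly us)) :: 'k mpoly set)
        \<longleftrightarrow> m \<in> multiples n (set (take (Suc j) us))" for j
    proof -
      have "set (take (Suc j) us) \<subseteq> mons n" using us(1) set_take_subset by fast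
      then show ?thesis
        using monomial_poly_in_monomial_ideal[of "set (take (Suc j) us)" n m, where 'k = 'k]
        by (simp add: monomial_ideal_def take_map)
    qed
    then show "decomp_fun n (map monomial_poly us) (monomial_poly m) = (monomial_poly (us ! j) :: 'k mpoly)"
      using jl by (simp add: decomp_fun_def j_def Q_def)
  qed
qed

theorem theorem1p8:
  fixes n d :: nat and u v :: mon and us :: "mon list" and I :: "('k::field) mpoly set"
  assumes "d \<ge> 2"
    and "u \<in> mons_of_deg n d" and "v \<in> mons_of_deg n d" and "u \<ge> v"
    and "completely_lexsegment n d (lexsegment n d u v)"
    and "I = monomial_ideal n (lexsegment n d u v)"
    and "has_linear_resolution n d I"
    and "set us = lexsegment n d u v" and "sorted_wrt (\<prec>) us"
  shows "regular_decomp n (map monomial_poly us :: 'k mpoly list)"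
  unfolding regular_decomp_def
proof (intro ballI)
  let ?L = "lexsegment n d u v"
  let ?gs = "map monomial_poly us :: 'k mpoly list"
  fix g s assume "g \<in> set ?gs" and s: "s \<in> lq_set n ?gs g"
  then obtain w where w: "w \<in> set us" and g: "g = monomial_poly w" by auto
  note lq = lq_set_monomial[OF assms(8,9), where 'k = 'k]
  have s': "s \<in> quot_set n d u v w" using s lq[OF w] g by simp
  have L: "?L \<subseteq> mons n" "mdeg w = d" "w \<in> ?L"
    using w assms(8) by (auto simp: lexsegment_def mons_of_deg_def)
  have "w + xv s \<in> multiples n (set us)"
    using s' w unfolding quot_set_def multiples_def by force
  then obtain y where y: "y \<in> set us" "w + xv s \<in> multiples n {y}"
    "\<And>w'. w' \<in> set us \<Longrightarrow> w' \<prec> y \<Longrightarrow> w + xv s \<notin> multiples n {w'}"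
    "decomp_fun n ?gs (monomial_poly (w + xv s)) = monomial_poly y"
    using decomp_fun_monomial[of us n, where 'k = 'k] assms(8,9) L(1) by metis
  have dec: "decomp_fun n ?gs (var s * g) = monomial_poly y"
    using y(4) by (simp add: g var_eq monomial_poly_add[symmetric] add.commute)
  \<comment> \<open>The cofactor has degree 1, which turns the minimality of y into the exchange
    form expected by \<open>quot_set_mono\<close>.\<close>
  have mult: "w + xv s \<in> multiples n {w'} \<longleftrightarrow> (\<exists>i\<in>{1..n}. w' + xv i = w + xv s)" if "w' \<in> ?L" for w'
    using that multiples_next_deg[of "{w'}" n d "w + xv s"] L(2) by (simp add: lexsegment_def mdeg_add)
  obtain i where i: "i \<in> {1..n}" "y + xv i = w + xv s"
    using y(1,2) mult assms(8) by auto
  have "quot_set n d u v y \<subseteq> quot_set n d u v w"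
  proof
    fix t assume "t \<in> quot_set n d u v y"
    then show "t \<in> quot_set n d u v w"
    proof (rule quot_set_mono[rotated -1])
      show "\<not> w' \<prec> y" if "w' \<in> ?L" "j \<in> {1..n}" "w' + xv j = w + xv s" for w' j
        using y(3)[of w'] mult[of w'] that assms(8) by blast
      show "swap_first v w t \<or> swap_later u w t"
        if "Poly_Mapping.lookup v 1 < Poly_Mapping.lookup u 1" "w \<in> ?L" "2 \<le> t" "t < i"
          "0 < Poly_Mapping.lookup w i" for w t i
        using assms(2-7) that by (rule linear_resolution_swap)
    qed (use assms i s' y(1) L(3) in \<open>auto simp: mons_of_deg_def\<close>)
  qed
  then show "lq_set n ?gs (decomp_fun n ?gs (var s * g)) \<subseteq> lq_set n ?gs g"
    using dec lq[OF w] lq[OF y(1)] g by simp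
qed

end
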